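(* Let $K_0\subseteq\overline{\mathbb{Q}}$ be a totally real field for which $\mathrm{JR}(\mathcal{O}_{K_0})$ is either an attained minimum or $\infty$, and let $K_1$ be the maximal totally real subfield of $K_0^{(2)}$. If $K\supseteq K_1$ is any totally real field with $\mathrm{JR}(\mathcal{O}_K)=\mathrm{JR}(\mathcal{O}_{K_0})$, and $L$ is any totally imaginary quadratic extension of $K$, then the first-order theory of $\mathcal{O}_L$ (in the language of rings) is undecidable.
   Context: $\mathcal{O}_F$ is the ring of algebraic integers of a field $F$. $F^{(2)}$ is the compositum in $\overline{\mathbb{Q}}$ of all extensions of $F$ of degree at most $2$. For a totally real $\alpha$ and $t\in\mathbb{R}$, write $0\ll\alpha\ll t$ if every conjugate of $\alpha$ lies in $(0,t)$. For a set $X$ of totally real numbers, $X_t=\{\alpha\in X:0\ll\alpha\ll t\}$ and $\mathrm{JR}(X)=\inf\{t\in\mathbb{R}:\#X_t=\infty\}$ (with $\inf\emptyset=\infty$). $\mathrm{JR}(X)$ is an attained minimum if it is finite and $X_{\mathrm{JR}(X)}$ is infinite. A field is totally real if all its elements have only real conjugates; totally imaginary means having no embedding into $\mathbb{R}$. *)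

theory Defs
  imports
    Complex_Main
    "HOL-Library.Extended_Real"
    "HOL-Library.Nat_Bijection"
    "HOL-Computational_Algebra.Computational_Algebra"
    "HOL-Algebra.Generated_Fields"
    "HOL-Algebra.Embedded_Algebras"
    "HOL-Algebra.Algebraic_Closure_Type"
begin

section \<open>Subfields of the algebraic closure of the rationals\<close>

text \<open>
  The algebraic closure of the rationals is taken inside the complex numbers, so every field below
  is a set of complex numbers that is a subfield of the following structure.
\<close>

abbreviation CC :: "complex ring"
  where "CC \<equiv> ring_of_type_algebra"

definition Qbar :: "complex set"
  where "Qbar = {z. Polynomial.algebraic z}"

definition ring_of_integers :: "complex set \<Rightarrow> complex set"
  where "ring_of_integers F = {z \<in> F. algebraic_int z}"

text \<open>
  \<open>ring.dimension CC n F E\<close> says that \<open>E\<close> has an \<open>F\<close>-basis of length \<open>n\<close>.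
\<close>

definition extension_of_degree :: "nat \<Rightarrow> complex set \<Rightarrow> complex set \<Rightarrow> bool"
  where "extension_of_degree n F E \<longleftrightarrow>
    subfield F CC \<and> subfield E CC \<and> F \<subseteq> E \<and> ring.dimension CC n F E"

text \<open>The field \<open>F\<^sup>(\<^sup>2\<^sup>)\<close>.\<close>

definition compositum2 :: "complex set \<Rightarrow> complex set"
  where "compositum2 F =
    generate_field CC (\<Union>{E. E \<subseteq> Qbar \<and> (\<exists>n\<le>2. extension_of_degree n F E)})"

text \<open>
  The conjugates of an algebraic number are the complex roots of its minimal polynomial, that is, of
  an irreducible rational polynomial that vanishes there (unique up to a constant factor). A
  transcendental number has no conjugates in this sense; it is not totally real either.
\<close>

definition conjugates :: "complex \<Rightarrow> complex set"
  where "conjugates \<alpha> = {\<beta>. \<exists>p :: rat poly. Factorial_Ring.irreducible p \<and>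
    poly (map_poly of_rat p) \<alpha> = 0 \<and> poly (map_poly of_rat p) \<beta> = 0}"

definition totally_real :: "complex \<Rightarrow> bool"
  where "totally_real \<alpha> \<longleftrightarrow> Polynomial.algebraic \<alpha> \<and> conjugates \<alpha> \<subseteq> range complex_of_real"

definition totally_real_field :: "complex set \<Rightarrow> bool"
  where "totally_real_field F \<longleftrightarrow> subfield F CC \<and> (\<forall>\<alpha>\<in>F. totally_real \<alpha>)"

definition totally_imaginary_field :: "complex set \<Rightarrow> bool"
  where "totally_imaginary_field F \<longleftrightarrow> subfield F CC \<and>
    ring_hom (CC\<lparr>carrier := F\<rparr>) (ring_of_type_algebra :: real ring) = {}"

definition maximal_totally_real_subfield :: "complex set \<Rightarrow> complex set \<Rightarrow> bool"
  where "maximal_totally_real_subfield E F \<longleftrightarrow>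
    totally_real_field E \<and> E \<subseteq> F \<and>
    (\<forall>E'. totally_real_field E' \<and> E \<subseteq> E' \<and> E' \<subseteq> F \<longrightarrow> E' = E)"


section \<open>The Julia Robinson number\<close>

text \<open>\<open>positive_below S t\<close> is the set \<open>S\<^sub>t\<close> of all \<open>\<alpha> \<in> S\<close> with \<open>0 \<lless> \<alpha> \<lless> t\<close>.\<close>

definition positive_below :: "complex set \<Rightarrow> real \<Rightarrow> complex set"
  where "positive_below S t =
    {\<alpha> \<in> S. totally_real \<alpha> \<and> conjugates \<alpha> \<subseteq> complex_of_real ` {0<..<t}}"

definition JR :: "complex set \<Rightarrow> ereal"
  where "JR S = Inf (ereal ` {t. infinite (positive_below S t)})"

definition JR_attained :: "complex set \<Rightarrow> bool"
  where "JR_attained S \<longleftrightarrow> (\<exists>t. JR S = ereal t \<and> infinite (positive_below S t))"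


section \<open>First-order formulas in the language of rings\<close>

datatype rterm =
    Var nat
  | Zero
  | One
  | Add rterm rterm
  | Neg rterm
  | Mul rterm rterm

datatype rform =
    FEq rterm rterm
  | FNot rform
  | FAnd rform rform
  | FEx nat rform

primrec term_vars :: "rterm \<Rightarrow> nat set"
  where
    "term_vars (Var i) = {i}"
  | "term_vars Zero = {}"
  | "term_vars One = {}"
  | "term_vars (Add s t) = term_vars s \<union> term_vars t"
  | "term_vars (Neg t) = term_vars t"
  | "term_vars (Mul s t) = term_vars s \<union> term_vars t"

primrec free_vars :: "rform \<Rightarrow> nat set"
  where
    "free_vars (FEq s t) = term_vars s \<union> term_vars t"
  | "free_vars (FNot \<phi>) = free_vars \<phi>"
  | "free_vars (FAnd \<phi> \<psi>) = free_vars \<phi> \<union> free_vars \<psi>"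
  | "free_vars (FEx i \<phi>) = free_vars \<phi> - {i}"

primrec term_val :: "(nat \<Rightarrow> 'a::comm_ring_1) \<Rightarrow> rterm \<Rightarrow> 'a"
  where
    "term_val e (Var i) = e i"
  | "term_val e Zero = 0"
  | "term_val e One = 1"
  | "term_val e (Add s t) = term_val e s + term_val e t"
  | "term_val e (Neg t) = - term_val e t"
  | "term_val e (Mul s t) = term_val e s * term_val e t"

text \<open>
  The structure is a subring \<open>A\<close> of the ambient ring: quantifiers range over \<open>A\<close>, and the operations
  are those of the ambient ring.
\<close>

primrec sat :: "'a::comm_ring_1 set \<Rightarrow> (nat \<Rightarrow> 'a) \<Rightarrow> rform \<Rightarrow> bool"
  where
    "sat A e (FEq s t) \<longleftrightarrow> term_val e s = term_val e t"
  | "sat A e (FNot \<phi>) \<longleftrightarrow> \<not> sat A e \<phi>"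
  | "sat A e (FAnd \<phi> \<psi>) \<longleftrightarrow> sat A e \<phi> \<and> sat A e \<psi>"
  | "sat A e (FEx i \<phi>) \<longleftrightarrow> (\<exists>a\<in>A. sat A (e(i := a)) \<phi>)"

definition first_order_theory :: "'a::comm_ring_1 set \<Rightarrow> rform set"
  where "first_order_theory A =
    {\<phi>. free_vars \<phi> = {} \<and> (\<forall>e. range e \<subseteq> A \<longrightarrow> sat A e \<phi>)}"


section \<open>Decidability\<close>

text \<open>
  \<open>recursive n f\<close> says that \<open>f\<close>, restricted to lists of length \<open>n\<close>, is a (total) general recursive
  function of \<open>n\<close> arguments; its values on lists of other lengths are irrelevant. Minimisation is
  applied to regular functions only, so that every function in the class is total.
\<close>

inductive recursive :: "nat \<Rightarrow> (nat list \<Rightarrow> nat) \<Rightarrow> bool"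
  where
    zero: "recursive n (\<lambda>xs. 0)"
  | succ: "recursive 1 (\<lambda>xs. Suc (xs ! 0))"
  | proj: "i < n \<Longrightarrow> recursive n (\<lambda>xs. xs ! i)"
  | comp: "recursive (length gs) f \<Longrightarrow> (\<And>g. g \<in> set gs \<Longrightarrow> recursive n g) \<Longrightarrow>
      recursive n (\<lambda>xs. f (map (\<lambda>g. g xs) gs))"
  | prim_rec: "recursive n f \<Longrightarrow> recursive (Suc (Suc n)) g \<Longrightarrow>
      recursive (Suc n) (\<lambda>xs. rec_nat (f (tl xs)) (\<lambda>y r. g (y # r # tl xs)) (hd xs))"
  | minimise: "recursive (Suc n) f \<Longrightarrow> (\<And>xs. length xs = n \<Longrightarrow> \<exists>y. f (y # xs) = 0) \<Longrightarrow>
      recursive n (\<lambda>xs. LEAST y. f (y # xs) = 0)"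

definition recursive_set :: "nat set \<Rightarrow> bool"
  where "recursive_set S \<longleftrightarrow>
    (\<exists>f. recursive 1 f \<and> (\<forall>x. f [x] = (if x \<in> S then 1 else 0)))"

text \<open>Goedel numbers, built with the Cantor pairing function.\<close>

primrec term_number :: "rterm \<Rightarrow> nat"
  where
    "term_number (Var i) = prod_encode (0, i)"
  | "term_number Zero = prod_encode (1, 0)"
  | "term_number One = prod_encode (2, 0)"
  | "term_number (Add s t) = prod_encode (3, prod_encode (term_number s, term_number t))"
  | "term_number (Neg t) = prod_encode (4, term_number t)"
  | "term_number (Mul s t) = prod_encode (5, prod_encode (term_number s, term_number t))"

primrec form_number :: "rform \<Rightarrow> nat"
  where
    "form_number (FEq s t) = prod_encode (0, prod_encode (term_number s, term_number t))"
  | "form_number (FNot \<phi>) = prod_encode (1, form_number \<phi>)"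
  | "form_number (FAnd \<phi> \<psi>) = prod_encode (2, prod_encode (form_number \<phi>, form_number \<psi>))"
  | "form_number (FEx i \<phi>) = prod_encode (3, prod_encode (i, form_number \<phi>))"

lemma term_number_inject [simp]: "term_number s = term_number t \<longleftrightarrow> s = t"
  by (induction s arbitrary: t) (case_tac t; simp)+

lemma form_number_inject [simp]: "form_number \<phi> = form_number \<psi> \<longleftrightarrow> \<phi> = \<psi>"
  by (induction \<phi> arbitrary: \<psi>) (case_tac \<psi>; simp)+

definition decidable :: "rform set \<Rightarrow> bool"
  where "decidable T \<longleftrightarrow> recursive_set (form_number ` T)"

end

theory Submission
  imports Defs "HOL-Number_Theory.Cong" "Jordan_Normal_Form.Char_Poly"
begin

text \<open>
  Write \<open>O\<close> for the ring of integers of \<open>L\<close>. A unit \<open>u\<close> of \<open>O\<close> that is congruent to 1 modulo 3 is real in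
  every embedding: \<open>t = (cnj u / u - 1) / 3\<close> is an algebraic integer all of whose conjugates have
  absolute value at most \<open>2 / 3\<close>, so \<open>t = 0\<close>. Hence the set of all \<open>x\<close> with \<open>36 x + 2 = u + 1 / u\<close> for
  such a \<open>u\<close> is definable and totally real, and it contains every integer \<open>e\<close>, because
  \<open>u = 1 + 18 e + 6 sqrt (e (9 e + 1))\<close> lies in \<open>L\<close>.

  For \<open>f = (\<Prod>i\<le>n. 1 + i\<^sup>2)\<close>, a large natural number \<open>g\<close> and \<open>h = (\<Prod>i\<le>n. 1 + g i\<^sup>2)\<close>, the elements \<open>x\<close> of this
  set for which \<open>1 + x\<^sup>2\<close> divides \<open>f\<close> and \<open>1 + g x\<^sup>2\<close> divides \<open>h\<close> are exactly the integers from \<open>-n\<close> to \<open>n\<close>: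
  the first condition bounds \<open>x\<close> on average over the conjugates, the second makes \<open>1 + g x\<^sup>2\<close>, which has
  a large norm, divide \<open>\<Prod>i\<le>n. i\<^sup>2 - x\<^sup>2\<close>, which therefore vanishes. Conversely, for arbitrary \<open>f \<noteq> 0\<close> only
  finitely many natural numbers \<open>k\<close> satisfy that \<open>1 + k\<^sup>2\<close> divides \<open>f\<close>, so any such set that contains 0 and
  is closed under successor except at \<open>n\<close> forces \<open>n\<close> to be a natural number. Thus the natural numbers
  are definable in \<open>O\<close>, and with them all recursive functions; Tarski's diagonal argument concludes.
\<close>

section \<open>Definability of recursive functions\<close>

primrec rename_term :: "(nat \<Rightarrow> nat) \<Rightarrow> rterm \<Rightarrow> rterm"
  where
    "rename_term \<rho> (Var i) = Var (\<rho> i)"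
  | "rename_term \<rho> Zero = Zero"
  | "rename_term \<rho> One = One"
  | "rename_term \<rho> (Add s t) = Add (rename_term \<rho> s) (rename_term \<rho> t)"
  | "rename_term \<rho> (Neg t) = Neg (rename_term \<rho> t)"
  | "rename_term \<rho> (Mul s t) = Mul (rename_term \<rho> s) (rename_term \<rho> t)"

primrec rename_form :: "(nat \<Rightarrow> nat) \<Rightarrow> rform \<Rightarrow> rform"
  where
    "rename_form \<rho> (FEq s t) = FEq (rename_term \<rho> s) (rename_term \<rho> t)"
  | "rename_form \<rho> (FNot \<phi>) = FNot (rename_form \<rho> \<phi>)"
  | "rename_form \<rho> (FAnd \<phi> \<psi>) = FAnd (rename_form \<rho> \<phi>) (rename_form \<rho> \<psi>)"
  | "rename_form \<rho> (FEx i \<phi>) = FEx (\<rho> i) (rename_form \<rho> \<phi>)"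

lemma term_val_rename: "term_val e (rename_term \<rho> t) = term_val (e \<circ> \<rho>) t"
  by (induction t) auto

text \<open>Injectivity keeps \<open>\<rho>\<close> from sending another variable to the index of
  the bound one, so updating an assignment commutes with renaming.\<close>

lemma sat_rename:
  assumes "inj \<rho>"
  shows "sat A e (rename_form \<rho> \<phi>) \<longleftrightarrow> sat A (e \<circ> \<rho>) \<phi>"
proof (induction \<phi> arbitrary: e)
  case (FEx i \<phi>)
  have "(e(\<rho> i := a)) \<circ> \<rho> = (e \<circ> \<rho>)(i := a)" for a
    using assms by (auto simp: fun_eq_iff inj_eq)
  then show ?case by (simp only: rename_form.simps sat.simps FEx)
qed (auto simp: term_val_rename)

lemma term_val_cong: "(\<And>i. i \<in> term_vars t \<Longrightarrow> e i = e' i) \<Longrightarrow> term_val e t = term_val e' t"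
  by (induction t) auto

lemma sat_cong: "(\<And>i. i \<in> free_vars \<phi> \<Longrightarrow> e i = e' i) \<Longrightarrow> sat A e \<phi> \<longleftrightarrow> sat A e' \<phi>"
proof (induction \<phi> arbitrary: e e')
  case (FEq s t)
  then show ?case using term_val_cong[of s e e'] term_val_cong[of t e e'] by simp
next
  case (FAnd \<phi> \<psi>)
  have "sat A e \<phi> \<longleftrightarrow> sat A e' \<phi>" "sat A e \<psi> \<longleftrightarrow> sat A e' \<psi>"
    by (rule FAnd.IH; use FAnd.prems in simp)+
  then show ?case by simp
next
  case (FEx i \<phi>)
  have "sat A (e(i := a)) \<phi> \<longleftrightarrow> sat A (e'(i := a)) \<phi>" for a
    by (rule FEx.IH) (use FEx.prems in auto)
  then show ?case by simp
next
  case (FNot \<phi>)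
  have "sat A e \<phi> \<longleftrightarrow> sat A e' \<phi>"
    by (rule FNot.IH) (use FNot.prems in simp)
  then show ?case by simp
qed

lemma finite_term_vars: "finite (term_vars t)"
  by (induction t) auto

lemma finite_free_vars: "finite (free_vars \<phi>)"
  by (induction \<phi>) (auto simp: finite_term_vars)

text \<open>Each surplus variable is bound by an existential quantifier and equated with 0, a legal
  witness because 0 lies in \<open>A\<close>. The diagonal argument uses this to remove stray free
  variables.\<close>

lemma ex_form_free_vars_zero:
  fixes A :: "'a::comm_ring_1 set"
  assumes "0 \<in> A" and "finite S"
  shows "\<exists>\<psi>. free_vars \<psi> = free_vars \<phi> - S \<and>
    (\<forall>e. sat A e \<psi> \<longleftrightarrow> sat A (\<lambda>i. if i \<in> S then 0 else e i) \<phi>)"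
  using assms(2)
proof (induction S rule: finite_induct)
  case empty
  then show ?case by (intro exI[of _ \<phi>]) simp
next
  case (insert x S)
  then obtain \<psi> where \<psi>: "free_vars \<psi> = free_vars \<phi> - S"
    "\<And>e. sat A e \<psi> \<longleftrightarrow> sat A (\<lambda>i. if i \<in> S then 0 else e i) \<phi>" by blast
  have "(\<lambda>i. if i \<in> S then 0 else (e(x := 0)) i) = (\<lambda>i. if i \<in> insert x S then 0 else e i)"
    for e :: "nat \<Rightarrow> 'a" by auto
  then show ?case
    using assms(1) \<psi>(1)
    by (intro exI[of _ "FEx x (FAnd (FEq (Var x) Zero) \<psi>)"])
      (simp add: \<psi>(2) insert_Diff_if Diff_insert2[symmetric] conj_commute del: fun_upd_apply,
        simp add: set_diff_eq ac_simps)
qed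

section \<open>Goedel's beta function\<close>

definition beta :: "nat \<Rightarrow> nat \<Rightarrow> nat \<Rightarrow> nat"
  where "beta c d i = c mod Suc (Suc i * d)"

text \<open>Chinese remaindering: if \<open>d\<close> is divisible by all differences of indices, a
  prime dividing two of the moduli 1 + (i + 1) d divides \<open>d\<close> and hence 1, so the moduli
  are pairwise coprime. A pair of numbers thus codes a finite sequence.\<close>

lemma ex_beta: "\<exists>c d. \<forall>i\<le>k. beta c d i = s i"
proof -
  \<comment> \<open>The summand \<open>k\<close> makes every difference of indices divide
    \<open>fact B\<close>; the sum of the values makes each \<open>s i\<close> smaller than its
    modulus, so that it is the remainder itself.\<close>
  define B where "B = (\<Sum>i\<le>k. s i) + k + 1"
  define d :: nat where "d = fact B"
  have fact: "x dvd d" if "0 < x" "x \<le> B" for x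
    unfolding d_def using that by (simp add: dvd_fact)
  have "coprime (Suc (Suc i * d)) (Suc (Suc j * d))" if "i < j" "j \<le> k" for i j
  proof (rule ccontr)
    assume "\<not> coprime (Suc (Suc i * d)) (Suc (Suc j * d))"
    then obtain c where "c dvd Suc (Suc i * d)" "c dvd Suc (Suc j * d)" "\<not> is_unit c"
      by (rule not_coprimeE)
    then obtain p where p: "prime p" "p dvd Suc (Suc i * d)" "p dvd Suc (Suc j * d)"
      using prime_factor_nat[of c] by (auto intro: dvd_trans)
    have "p dvd (Suc (Suc j * d)) - Suc (Suc i * d)"
      using p by (meson dvd_diff_nat)
    also have "(Suc (Suc j * d)) - Suc (Suc i * d) = (j - i) * d"
      by (simp add: diff_mult_distrib)
    finally have "p dvd (j - i) * d" .
    moreover have "(j - i) dvd d" using that by (intro fact) (auto simp: B_def)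
    ultimately have "p dvd d" using p(1) by (meson dvd_trans prime_dvd_multD)
    then have "p dvd Suc (Suc i * d) - Suc i * d"
      using p(2) by (intro dvd_diff_nat dvd_mult)
    then show False using p(1) by simp
  qed
  then have cop: "\<forall>i\<in>{..k}. \<forall>j\<in>{..k}. i \<noteq> j \<longrightarrow> coprime (Suc (Suc i * d)) (Suc (Suc j * d))"
    by (metis atMost_iff coprime_commute linorder_neqE_nat)
  obtain c where c: "\<forall>i\<in>{..k}. [c = s i] (mod Suc (Suc i * d))"
    using chinese_remainder_nat[OF _ cop, of s] by auto
  have "beta c d i = s i" if "i \<le> k" for i
  proof -
    have "s i \<le> (\<Sum>i\<le>k. s i)" using that by (intro member_le_sum) auto
    also have "\<dots> \<le> d" using fact_ge_self[of B] by (simp add: B_def d_def)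
    finally have "s i < Suc (Suc i * d)" by simp
    then show ?thesis using c that by (simp add: beta_def cong_def del: mult_Suc)
  qed
  then show ?thesis by blast
qed

section \<open>Relations and functions on the naturals definable in a ring\<close>

text \<open>There is one formula per variable index because the quantifiers to be relativised to the
  naturals bind variables of varying index.\<close>

locale definable_nats =
  fixes A :: "'a::{comm_ring_1,ring_char_0} set" and \<nu> :: "nat \<Rightarrow> rform"
  assumes of_nat_mem: "of_nat k \<in> A"
    and sat_nu: "e i \<in> A \<Longrightarrow> sat A e (\<nu> i) \<longleftrightarrow> e i \<in> \<nat>"
begin

text \<open>Only assignments with natural values are tested. Variables from \<open>n\<close> on may
  occur free in the formula, but such assignments cannot make its truth depend on them.\<close>

definition definable :: "nat \<Rightarrow> (nat list \<Rightarrow> bool) \<Rightarrow> bool"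
  where "definable n P \<longleftrightarrow> (\<exists>\<phi>. \<forall>v. sat A (of_nat \<circ> v) \<phi> \<longleftrightarrow> P (map v [0..<n]))"

definition definable_fun :: "nat \<Rightarrow> (nat list \<Rightarrow> nat) \<Rightarrow> bool"
  where "definable_fun n f \<longleftrightarrow> definable (Suc n) (\<lambda>xs. xs ! n = f (take n xs))"

lemma definable_cong: "(\<And>xs. length xs = n \<Longrightarrow> P xs \<longleftrightarrow> Q xs) \<Longrightarrow> definable n P \<longleftrightarrow> definable n Q"
  by (simp add: definable_def)

lemma definable_not: "definable n P \<Longrightarrow> definable n (\<lambda>xs. \<not> P xs)"
  unfolding definable_def by (metis sat.simps(2))

lemma definable_and: "definable n P \<Longrightarrow> definable n Q \<Longrightarrow> definable n (\<lambda>xs. P xs \<and> Q xs)"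
  unfolding definable_def by (metis sat.simps(3))

lemma definable_imp: "definable n P \<Longrightarrow> definable n Q \<Longrightarrow> definable n (\<lambda>xs. P xs \<longrightarrow> Q xs)"
  using definable_not[OF definable_and[OF _ definable_not], of n P Q] by simp

lemma definable_ex_append:
  assumes "definable (Suc n) P"
  shows "definable n (\<lambda>xs. \<exists>k. P (xs @ [k]))"
proof -
  obtain \<phi> where \<phi>: "\<And>v. sat A (of_nat \<circ> v) \<phi> \<longleftrightarrow> P (map v [0..<Suc n])"
    using assms definable_def by auto
  have *: "(of_nat \<circ> v)(n := of_nat k) = of_nat \<circ> v(n := k)" for v :: "nat \<Rightarrow> nat" and k
    by auto
  have upd: "map (v(n := k)) [0..<Suc n] = map v [0..<n] @ [k]" for v :: "nat \<Rightarrow> nat" and k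
    by simp
  have "sat A (of_nat \<circ> v) (FEx n (FAnd (\<nu> n) \<phi>)) \<longleftrightarrow> (\<exists>k. P (map v [0..<n] @ [k]))" for v
  proof -
    have "sat A (of_nat \<circ> v) (FEx n (FAnd (\<nu> n) \<phi>)) \<longleftrightarrow>
        (\<exists>a\<in>A. a \<in> \<nat> \<and> sat A ((of_nat \<circ> v)(n := a)) \<phi>)"
      by (simp add: sat_nu)
    also have "\<dots> \<longleftrightarrow> (\<exists>k. sat A ((of_nat \<circ> v)(n := of_nat k)) \<phi>)"
      using of_nat_mem by (metis Nats_cases of_nat_in_Nats)
    also have "\<dots> \<longleftrightarrow> (\<exists>k. P (map v [0..<n] @ [k]))"
      unfolding * \<phi> upd ..
    finally show ?thesis .
  qed
  then show ?thesis unfolding definable_def by blast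
qed

lemma definable_ex:
  assumes "definable (Suc n) (\<lambda>xs. P (take n xs) (xs ! n))"
  shows "definable n (\<lambda>xs. \<exists>k. P xs k)"
proof -
  have "definable n (\<lambda>xs. \<exists>k. P xs k) \<longleftrightarrow>
      definable n (\<lambda>xs. \<exists>k. P (take n (xs @ [k])) ((xs @ [k]) ! n))"
    by (rule definable_cong) (simp add: nth_append)
  then show ?thesis using definable_ex_append[OF assms] by simp
qed

lemma definable_ex_list:
  "definable (n + m) P \<Longrightarrow> definable n (\<lambda>xs. \<exists>ys. length ys = m \<and> P (xs @ ys))"
proof (induct m arbitrary: P)
  case 0
  then show ?case by simp
next
  case (Suc m)
  have "definable n (\<lambda>xs. \<exists>ys. length ys = m \<and> (\<exists>k. P ((xs @ ys) @ [k])))"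
    using Suc.hyps[OF definable_ex_append[of "n + m" P]] Suc.prems by simp
  moreover have "(\<exists>ys. length ys = m \<and> (\<exists>k. P ((xs @ ys) @ [k]))) \<longleftrightarrow>
      (\<exists>ys. length ys = Suc m \<and> P (xs @ ys))" for xs
    by (auto simp: length_Suc_conv_rev)
  ultimately show ?case by simp
qed

lemma definable_True: "definable n (\<lambda>_. True)"
  unfolding definable_def by (rule exI[of _ "FEq Zero Zero"]) simp

lemma definable_eq_nth: "i < n \<Longrightarrow> j < n \<Longrightarrow> definable n (\<lambda>xs. xs ! i = xs ! j)"
  unfolding definable_def by (rule exI[of _ "FEq (Var i) (Var j)"]) simp

lemma definable_ball_less: "(\<And>k::nat. k < m \<Longrightarrow> definable n (P k)) \<Longrightarrow> definable n (\<lambda>xs. \<forall>k<m. P k xs)"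
proof (induction m)
  case (Suc m)
  then have "definable n (\<lambda>xs. (\<forall>k<m. P k xs) \<and> P m xs)" by (intro definable_and) auto
  moreover have "(\<forall>k<Suc m. P k xs) \<longleftrightarrow> (\<forall>k<m. P k xs) \<and> P m xs" for xs
    by (auto simp: less_Suc_eq)
  ultimately show ?case by simp
qed (simp add: definable_True)

text \<open>Capture is avoided by shifting the formula by \<open>n\<close>: its arguments then sit
  in \<open>m\<close> fresh variables, which are equated with the chosen ones and quantified
  away.\<close>

lemma definable_subst:
  assumes "definable m P" and "length js = m" and "set js \<subseteq> {..<n}"
  shows "definable n (\<lambda>xs. P (map ((!) xs) js))"
proof -
  obtain \<phi> where \<phi>: "\<And>v. sat A (of_nat \<circ> v) \<phi> \<longleftrightarrow> P (map v [0..<m])"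
    using assms(1) definable_def by auto
  have shift: "map (v \<circ> (+) n) [0..<m] = drop n (map v [0..<n + m])" for v :: "nat \<Rightarrow> nat"
    by (rule nth_equalityI) auto
  have "sat A (of_nat \<circ> v) (rename_form ((+) n) \<phi>) \<longleftrightarrow> P (drop n (map v [0..<n + m]))" for v
    by (simp add: sat_rename comp_assoc \<phi> shift del: map_map)
  then have "definable (n + m) (\<lambda>xs. P (drop n xs))" unfolding definable_def by blast
  moreover have "definable (n + m) (\<lambda>xs. \<forall>k<m. xs ! (n + k) = xs ! (js ! k))"
    using assms(2,3) by (intro definable_ball_less definable_eq_nth) (auto simp: subset_iff trans_less_add1)
  ultimately have "definable n (\<lambda>xs. \<exists>ys. length ys = m \<and>
      P (drop n (xs @ ys)) \<and> (\<forall>k<m. (xs @ ys) ! (n + k) = (xs @ ys) ! (js ! k)))"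
    by (intro definable_ex_list definable_and)
  then show ?thesis
  proof (rule iffD1[OF definable_cong, rotated])
    fix xs :: "nat list"
    assume len: "length xs = n"
    have "(\<forall>k<m. (xs @ ys) ! (n + k) = (xs @ ys) ! (js ! k)) \<longleftrightarrow> ys = map ((!) xs) js"
      if "length ys = m" for ys
      using that len assms(2,3) by (auto simp: nth_append list_eq_iff_nth_eq subset_iff)
    then show "(\<exists>ys. length ys = m \<and>
      P (drop n (xs @ ys)) \<and> (\<forall>k<m. (xs @ ys) ! (n + k) = (xs @ ys) ! (js ! k))) \<longleftrightarrow>
        P (map ((!) xs) js)"
      using len assms(2) by (metis append_eq_conv_conj length_map)
  qed
qed

lemma definable_fun_nth: "i < n \<Longrightarrow> definable_fun n (\<lambda>xs. xs ! i)"
  unfolding definable_fun_def using definable_cong[of "Suc n" "\<lambda>xs. xs ! n = xs ! i" "\<lambda>xs. xs ! n = take n xs ! i"]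
  by (simp add: definable_eq_nth)

text \<open>Weakening by an ignored last argument, required whenever a quantifier or a graph adds a
  variable.\<close>

lemma definable_fun_take:
  assumes "definable_fun n f" shows "definable_fun (Suc n) (\<lambda>xs. f (take n xs))"
proof -
  have "definable (Suc (Suc n)) (\<lambda>xs. map ((!) xs) ([0..<n] @ [Suc n]) ! n =
      f (take n (map ((!) xs) ([0..<n] @ [Suc n]))))"
    using assms unfolding definable_fun_def by (rule definable_subst) auto
  then show ?thesis
    unfolding definable_fun_def
  proof (rule iffD1[OF definable_cong, rotated])
    fix xs :: "nat list"
    assume "length xs = Suc (Suc n)"
    then have "map ((!) xs) [0..<n] = take n (take (Suc n) xs)" by (simp add: list_eq_iff_nth_eq)
    then show "map ((!) xs) ([0..<n] @ [Suc n]) ! n = f (take n (map ((!) xs) ([0..<n] @ [Suc n])))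
        \<longleftrightarrow> xs ! Suc n = f (take n (take (Suc n) xs))"
      using \<open>length xs = Suc (Suc n)\<close> by (simp add: nth_append)
  qed
qed

text \<open>The intermediate values are quantified as a tuple in the variables from \<open>n\<close>
  on, each fixed by the graph of its function.\<close>

lemma definable_comp:
  assumes "definable (length gs) P" and "\<And>g. g \<in> set gs \<Longrightarrow> definable_fun n g"
  shows "definable n (\<lambda>xs. P (map (\<lambda>g. g xs) gs))"
proof -
  let ?m = "length gs"
  have "definable (n + ?m) (\<lambda>xs. P (map ((!) xs) [n..<n + ?m]))"
    using assms(1) by (rule definable_subst) auto
  moreover have "definable (n + ?m) (\<lambda>xs. xs ! (n + k) = (gs ! k) (take n xs))" if "k < ?m" for k
  proof -
    have "definable (n + ?m) (\<lambda>xs. map ((!) xs) ([0..<n] @ [n + k]) ! n =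
        (gs ! k) (take n (map ((!) xs) ([0..<n] @ [n + k]))))"
      using assms(2)[of "gs ! k"] that unfolding definable_fun_def by (intro definable_subst) auto
    then show ?thesis
    proof (rule iffD1[OF definable_cong, rotated])
      fix xs :: "nat list"
      assume "length xs = n + ?m"
      then have "take n (map ((!) xs) ([0..<n] @ [n + k])) = take n xs"
        by (intro nth_equalityI) (auto simp: nth_append)
      then show "map ((!) xs) ([0..<n] @ [n + k]) ! n =
          (gs ! k) (take n (map ((!) xs) ([0..<n] @ [n + k]))) \<longleftrightarrow> xs ! (n + k) = (gs ! k) (take n xs)"
        using \<open>length xs = n + ?m\<close> by (simp add: nth_append)
    qed
  qed
  ultimately have "definable n (\<lambda>xs. \<exists>ys. length ys = ?m \<and> P (map ((!) (xs @ ys)) [n..<n + ?m]) \<and>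
      (\<forall>k<?m. (xs @ ys) ! (n + k) = (gs ! k) (take n (xs @ ys))))"
    by (intro definable_ex_list definable_and definable_ball_less)
  then show ?thesis
  proof (rule iffD1[OF definable_cong, rotated])
    fix xs :: "nat list"
    assume len: "length xs = n"
    have "(\<forall>k<?m. (xs @ ys) ! (n + k) = (gs ! k) (take n (xs @ ys))) \<longleftrightarrow> ys = map (\<lambda>g. g xs) gs"
      if "length ys = ?m" for ys
      using that len by (auto simp: nth_append list_eq_iff_nth_eq)
    moreover have "map ((!) (xs @ ys)) [n..<n + ?m] = ys" if "length ys = ?m" for ys
      using that len by (intro nth_equalityI) (auto simp: nth_append)
    ultimately have "length ys = ?m \<and> P (map ((!) (xs @ ys)) [n..<n + ?m]) \<and>
        (\<forall>k<?m. (xs @ ys) ! (n + k) = (gs ! k) (take n (xs @ ys))) \<longleftrightarrow>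
        ys = map (\<lambda>g. g xs) gs \<and> P (map (\<lambda>g. g xs) gs)" for ys
      by (cases "length ys = ?m") auto
    then show "(\<exists>ys. length ys = ?m \<and> P (map ((!) (xs @ ys)) [n..<n + ?m]) \<and>
      (\<forall>k<?m. (xs @ ys) ! (n + k) = (gs ! k) (take n (xs @ ys)))) \<longleftrightarrow> P (map (\<lambda>g. g xs) gs)"
      by simp
  qed
qed

lemma definable_fun_comp:
  assumes "definable_fun (length gs) f" and "\<And>g. g \<in> set gs \<Longrightarrow> definable_fun n g"
  shows "definable_fun n (\<lambda>xs. f (map (\<lambda>g. g xs) gs))"
proof -
  \<comment> \<open>The final projection carries the variable that holds the value of the
    composite.\<close>
  let ?gs = "map (\<lambda>g xs. g (take n xs)) gs @ [\<lambda>xs. xs ! n]"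
  have "definable (Suc n) (\<lambda>xs. map (\<lambda>g. g xs) ?gs ! length gs = f (take (length gs) (map (\<lambda>g. g xs) ?gs)))"
    using assms by (intro definable_comp) (auto simp: definable_fun_def[of "length gs"] definable_fun_take definable_fun_nth)
  then show ?thesis
    unfolding definable_fun_def by (rule iffD1[OF definable_cong, rotated]) (simp add: nth_append comp_def)
qed

lemma definable_eq:
  assumes "definable_fun n f" "definable_fun n g" shows "definable n (\<lambda>xs. f xs = g xs)"
proof -
  have "definable 2 (\<lambda>xs. xs ! 0 = xs ! 1)" by (rule definable_eq_nth) auto
  then have "definable n (\<lambda>xs. map (\<lambda>h. h xs) [f, g] ! 0 = map (\<lambda>h. h xs) [f, g] ! 1)"
    using assms by (intro definable_comp) (auto simp: numeral_2_eq_2)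
  then show ?thesis by simp
qed

lemma definable_fun_comp2:
  assumes "definable_fun 2 (\<lambda>xs. h (xs ! 0) (xs ! 1))" "definable_fun n f" "definable_fun n g" shows "definable_fun n (\<lambda>xs. h (f xs) (g xs))"
proof -
  have "definable_fun n (\<lambda>xs. h (map (\<lambda>g. g xs) [f, g] ! 0) (map (\<lambda>g. g xs) [f, g] ! 1))"
    by (rule definable_fun_comp) (use assms in \<open>auto simp: numeral_2_eq_2\<close>)
  then show ?thesis by simp
qed

lemma definable_fun_add: "definable_fun n f \<Longrightarrow> definable_fun n g \<Longrightarrow> definable_fun n (\<lambda>xs. f xs + g xs)"
proof (rule definable_fun_comp2[where h = "(+)"])
  have "sat A (of_nat \<circ> v) (FEq (Var 2) (Add (Var 0) (Var 1))) \<longleftrightarrow> v 2 = v 0 + v 1" for v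
    by (simp flip: of_nat_add)
  then show "definable_fun 2 (\<lambda>xs. xs ! 0 + xs ! 1)" unfolding definable_fun_def definable_def
    by (intro exI[of _ "FEq (Var 2) (Add (Var 0) (Var 1))"])
       (simp add: numeral_2_eq_2 del: sat.simps upt_Suc)
qed

lemma definable_fun_mult: "definable_fun n f \<Longrightarrow> definable_fun n g \<Longrightarrow> definable_fun n (\<lambda>xs. f xs * g xs)"
proof (rule definable_fun_comp2[where h = times])
  have "sat A (of_nat \<circ> v) (FEq (Var 2) (Mul (Var 0) (Var 1))) \<longleftrightarrow> v 2 = v 0 * v 1" for v
    by (simp flip: of_nat_mult)
  then show "definable_fun 2 (\<lambda>xs. xs ! 0 * xs ! 1)" unfolding definable_fun_def definable_def
    by (intro exI[of _ "FEq (Var 2) (Mul (Var 0) (Var 1))"])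
       (simp add: numeral_2_eq_2 del: sat.simps upt_Suc)
qed

lemma definable_fun_0: "definable_fun n (\<lambda>_. 0)"
  unfolding definable_fun_def definable_def by (rule exI[of _ "FEq (Var n) Zero"]) (simp add: nth_append)

lemma definable_fun_1: "definable_fun n (\<lambda>_. 1)"
  unfolding definable_fun_def definable_def by (rule exI[of _ "FEq (Var n) One"]) (simp add: nth_append)

lemma definable_fun_Suc: "definable_fun n f \<Longrightarrow> definable_fun n (\<lambda>xs. Suc (f xs))"
  using definable_fun_add[OF _ definable_fun_1] by simp

lemma definable_less:
  assumes "definable_fun n f" "definable_fun n g" shows "definable n (\<lambda>xs. f xs < g xs)"
proof -
  have "definable n (\<lambda>xs. \<exists>k. g xs = Suc (f xs + k))"
    using assms by (intro definable_ex definable_eq definable_fun_Suc definable_fun_add definable_fun_take definable_fun_nth) auto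
  then show ?thesis by (simp add: less_iff_Suc_add)
qed

lemma definable_fun_The:
  assumes "definable (Suc n) (\<lambda>xs. P (take n xs) (xs ! n))"
    and "\<And>xs y. length xs = n \<Longrightarrow> P xs y \<longleftrightarrow> y = f xs"
  shows "definable_fun n f"
  unfolding definable_fun_def by (rule iffD1[OF definable_cong assms(1)]) (simp add: assms(2))

lemma definable_fun_mod_Suc:
  assumes "definable_fun n f" "definable_fun n g" shows "definable_fun n (\<lambda>xs. f xs mod Suc (g xs))"
proof (rule definable_fun_The)
  show "definable (Suc n) (\<lambda>xs. \<exists>q. f (take n xs) = q * Suc (g (take n xs)) + xs ! n \<and> xs ! n < Suc (g (take n xs)))"
    using assms by (intro definable_ex definable_and definable_eq definable_less
        definable_fun_add definable_fun_mult definable_fun_Suc definable_fun_take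
        definable_fun_nth definable_fun_nth[THEN definable_fun_take]) auto
  show "(\<exists>q. f xs = q * Suc (g xs) + y \<and> y < Suc (g xs)) \<longleftrightarrow> y = f xs mod Suc (g xs)" for xs y
    using div_mult_mod_eq[of "f xs" "Suc (g xs)"]
    by (auto simp del: mult_Suc_right intro!: exI[of _ "f xs div Suc (g xs)"])
qed

lemma definable_fun_beta: "definable_fun n f \<Longrightarrow> definable_fun n g \<Longrightarrow> definable_fun n h \<Longrightarrow> definable_fun n (\<lambda>xs. beta (f xs) (g xs) (h xs))"
  unfolding beta_def by (intro definable_fun_mod_Suc definable_fun_mult definable_fun_Suc)

lemma definable_fun_subst:
  assumes "definable_fun (length js) f" "set js \<subseteq> {..<n}"
  shows "definable_fun n (\<lambda>xs. f (map ((!) xs) js))"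
proof -
  have "definable_fun n (\<lambda>xs. f (map (\<lambda>g. g xs) (map (\<lambda>j xs. xs ! j) js)))"
    using assms by (intro definable_fun_comp) (auto intro!: definable_fun_nth)
  then show ?thesis by (simp add: comp_def)
qed

lemma definable_all_append: "definable (Suc n) P \<Longrightarrow> definable n (\<lambda>xs. \<forall>k. P (xs @ [k]))"
  using definable_not[OF definable_ex_append[OF definable_not]] by simp

text \<open>The whole course of values up to the recursion argument is coded by one pair
  \<open>c\<close>, \<open>d\<close> through \<open>beta\<close>; the graph asks for a pair with the
  right start, the right steps and the right end.\<close>

lemma definable_fun_prim_rec:
  assumes f: "definable_fun n f" and g: "definable_fun (Suc (Suc n)) g"
  shows "definable_fun (Suc n) (\<lambda>xs. rec_nat (f (tl xs)) (\<lambda>y r. g (y # r # tl xs)) (hd xs))"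
proof -
  \<comment> \<open>Variable 0 is the recursion argument, 1 to n are the parameters, n + 1 is the
    value, n + 2 and n + 3 are \<open>c\<close> and \<open>d\<close>, and n + 4 is the index of a
    step.\<close>
  let ?js = "[1..<Suc n]"
  let ?gs = "(\<lambda>ys. ys ! (n + 4)) # (\<lambda>ys. beta (ys ! (n + 2)) (ys ! (n + 3)) (ys ! (n + 4))) #
    map (\<lambda>j ys. ys ! j) ?js"
  let ?step = "\<lambda>ys. ys ! (n + 4) < ys ! 0 \<longrightarrow>
    beta (ys ! (n + 2)) (ys ! (n + 3)) (Suc (ys ! (n + 4))) = g (map (\<lambda>g. g ys) ?gs)"
  have "definable (Suc (n + 4)) ?step"
  proof (intro definable_imp definable_less definable_eq definable_fun_comp)
    have "length ?gs = Suc (Suc n)" by (simp del: upt_Suc)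
    then show "definable_fun (length ?gs) g" using g by (simp only:)
  qed (auto intro!: definable_fun_nth definable_fun_beta definable_fun_Suc)
  then have step: "definable (n + 4) (\<lambda>xs. \<forall>i. ?step (xs @ [i]))"
    by (rule definable_all_append)
  let ?body = "\<lambda>ys. beta (ys ! (n + 2)) (ys ! (n + 3)) 0 = f (map ((!) ys) ?js) \<and>
    ys ! (n + 1) = beta (ys ! (n + 2)) (ys ! (n + 3)) (ys ! 0) \<and> (\<forall>i. ?step (ys @ [i]))"
  have "definable (n + 4) ?body"
  proof (intro definable_and definable_eq definable_fun_subst)
    have "length ?js = n" by (simp del: upt_Suc)
    then show "definable_fun (length ?js) f" using f by (simp only:)
    show "definable (n + 4) (\<lambda>xs. \<forall>i. ?step (xs @ [i]))" by (rule step)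
  qed (auto intro!: definable_fun_nth definable_fun_beta definable_fun_0 simp del: upt_Suc)
  moreover have "n + 4 = Suc (Suc (Suc (Suc n)))" by simp
  ultimately have "definable (Suc (Suc (Suc (Suc n)))) ?body" by (simp only:)
  then have "definable (Suc (Suc n)) (\<lambda>xs. \<exists>c d. ?body ((xs @ [c]) @ [d]))"
    by (intro definable_ex_append)
  then show ?thesis
    unfolding definable_fun_def
  proof (rule iffD1[OF definable_cong, rotated])
    fix xs :: "nat list"
    assume len: "length xs = Suc (Suc n)"
    then obtain k us z where xs: "xs = k # us @ [z]" and us: "length us = n"
      by (metis length_Suc_conv length_Suc_conv_rev)
    define h where "h = rec_nat (f us) (\<lambda>y r. g (y # r # us))"
    have js: "map ((!) (k # us @ zs)) ?js = us" for zs
      using us by (intro nth_equalityI) (auto simp: nth_append simp del: upt_Suc)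
    have gs: "map (\<lambda>g. g ((xs @ [c]) @ [d] @ [i])) ?gs = i # beta c d i # us" for c d i
      using us js[of "[z, c, d, i]"] by (simp add: xs nth_append comp_def del: upt_Suc)
    have body: "?body ((xs @ [c]) @ [d]) \<longleftrightarrow> beta c d 0 = f us \<and> z = beta c d k \<and>
        (\<forall>i<k. beta c d (Suc i) = g (i # beta c d i # us))" for c d
      using us js[of "[z, c, d]"] gs[of c d]
      by (simp add: xs nth_append del: upt_Suc list.map nth_Cons')
    have "(\<exists>c d. ?body ((xs @ [c]) @ [d])) \<longleftrightarrow> z = h k"
    proof
      assume "\<exists>c d. ?body ((xs @ [c]) @ [d])"
      then obtain c d where cd: "beta c d 0 = f us" "z = beta c d k"
        "\<And>i. i < k \<Longrightarrow> beta c d (Suc i) = g (i # beta c d i # us)"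
        unfolding body by blast
      have "i \<le> k \<Longrightarrow> beta c d i = h i" for i
        by (induction i) (auto simp: cd h_def)
      then show "z = h k" using cd by simp
    next
      assume "z = h k"
      obtain c d where "\<And>i. i \<le> k \<Longrightarrow> beta c d i = h i" using ex_beta[of k h] by blast
      then show "\<exists>c d. ?body ((xs @ [c]) @ [d])"
        unfolding body using \<open>z = h k\<close> by (intro exI[of _ c] exI[of _ d]) (auto simp: h_def)
    qed
    then show "(\<exists>c d. ?body ((xs @ [c]) @ [d])) \<longleftrightarrow> xs ! Suc n =
      rec_nat (f (tl (take (Suc n) xs))) (\<lambda>y r. g (y # r # tl (take (Suc n) xs))) (hd (take (Suc n) xs))"
      using us by (simp add: xs h_def nth_append)
  qed
qed

lemma definable_fun_Least:
  assumes "definable_fun (Suc n) f" and ex: "\<And>xs. length xs = n \<Longrightarrow> \<exists>y. f (y # xs) = 0"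
  shows "definable_fun n (\<lambda>xs. LEAST y. f (y # xs) = 0)"
proof -
  have f: "definable N (\<lambda>xs. f (map ((!) xs) (i # [0..<n])) = 0)" if "i < N" "n \<le> N" for N i
  proof (rule definable_eq[OF definable_fun_subst definable_fun_0])
    show "definable_fun (length (i # [0..<n])) f" using assms(1) by simp
  qed (use that in auto)
  \<comment> \<open>Variable \<open>n\<close> holds the candidate for the least zero, and variable n
    + 1 runs over the smaller numbers.\<close>
  let ?body = "\<lambda>ys. ys ! Suc n < ys ! n \<longrightarrow> f (map ((!) ys) (Suc n # [0..<n])) \<noteq> 0"
  have "definable (Suc (Suc n)) ?body"
    by (intro definable_imp definable_less definable_not f definable_fun_nth) auto
  then have "definable (Suc n) (\<lambda>xs. f (map ((!) xs) (n # [0..<n])) = 0 \<and> (\<forall>k. ?body (xs @ [k])))"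
    by (intro definable_and f definable_all_append) auto
  then show ?thesis
    unfolding definable_fun_def
  proof (rule iffD1[OF definable_cong, rotated])
    fix xs :: "nat list"
    assume "length xs = Suc n"
    then obtain us z where xs: "xs = us @ [z]" and us: "length us = n"
      by (metis length_Suc_conv_rev)
    have js: "map ((!) (us @ zs)) [0..<n] = us" for zs
      using us by (intro nth_equalityI) (auto simp: nth_append)
    have "f (z # us) = 0 \<and> (\<forall>k<z. f (k # us) \<noteq> 0) \<longleftrightarrow> z = (LEAST y. f (y # us) = 0)"
      using ex[OF us] by (metis (mono_tags, lifting) LeastI_ex Least_le linorder_neqE_nat not_less)
    then show "(f (map ((!) xs) (n # [0..<n])) = 0 \<and> (\<forall>k. ?body (xs @ [k]))) \<longleftrightarrow>
        xs ! n = (LEAST y. f (y # take n xs) = 0)"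
      using us by (simp add: xs js nth_append)
  qed
qed

lemma recursive_imp_definable_fun: "recursive n f \<Longrightarrow> definable_fun n f"
proof (induction rule: recursive.induct)
  case (zero n)
  then show ?case by (rule definable_fun_0)
next
  case succ
  then show ?case by (intro definable_fun_Suc definable_fun_nth) simp
next
  case (proj i n)
  then show ?case by (rule definable_fun_nth)
next
  case (comp gs f n)
  then show ?case by (intro definable_fun_comp) auto
next
  case (prim_rec n f g)
  then show ?case by (intro definable_fun_prim_rec)
next
  case (minimise n f)
  then show ?case by (intro definable_fun_Least)
qed

end

section \<open>Recursiveness of the coding of formulas\<close>

lemma recursive_comp1:
  assumes "recursive 1 f" "recursive n g" shows "recursive n (\<lambda>xs. f [g xs])"
  using recursive.comp[of "[g]" f n] assms by simp

lemma recursive_comp2: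
  assumes "recursive 2 f" "recursive n g" "recursive n h" shows "recursive n (\<lambda>xs. f [g xs, h xs])"
proof -
  have "recursive n (\<lambda>xs. f (map (\<lambda>g. g xs) [g, h]))"
    by (rule recursive.comp) (use assms in \<open>auto simp: numeral_2_eq_2\<close>)
  then show ?thesis by simp
qed

lemma recursive_Suc: "recursive n f \<Longrightarrow> recursive n (\<lambda>xs. Suc (f xs))"
  using recursive_comp1[OF recursive.succ, of n f] by simp

lemma recursive_const: "recursive n (\<lambda>_. c)"
  by (induction c) (auto intro: recursive.zero recursive_Suc)

lemma recursive_rec_nat:
  assumes "recursive 2 (\<lambda>xs. g (xs ! 0) (xs ! 1))" and "recursive n h"
  shows "recursive n (\<lambda>xs. rec_nat c g (h xs))"
proof -
  have "recursive (Suc 0) (\<lambda>xs. rec_nat c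
      (\<lambda>y r. g ((y # r # tl xs) ! 0) ((y # r # tl xs) ! 1)) (hd xs))"
    using assms(1) by (intro recursive.prim_rec recursive_const) (simp add: numeral_2_eq_2)
  then have "recursive 1 (\<lambda>xs. rec_nat c g (hd xs))" by simp
  from recursive_comp1[OF this assms(2)] show ?thesis by simp
qed

lemma recursive_add:
  assumes "recursive n f" "recursive n g" shows "recursive n (\<lambda>xs. f xs + g xs)"
proof -
  have "recursive (Suc 1) (\<lambda>xs. rec_nat (tl xs ! 0) (\<lambda>y r. Suc ((y # r # tl xs) ! 1)) (hd xs))"
    by (intro recursive.prim_rec[of 1 "\<lambda>xs. xs ! 0" "\<lambda>xs. Suc (xs ! 1)"] recursive_Suc recursive.proj) auto
  then have "recursive 2 (\<lambda>xs. rec_nat (tl xs ! 0) (\<lambda>_. Suc) (hd xs))"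
    by (simp add: numeral_2_eq_2)
  moreover have "rec_nat b (\<lambda>_. Suc) a = a + b" for a b
    by (induction a) auto
  ultimately show ?thesis using recursive_comp2[OF _ assms, of "\<lambda>xs. rec_nat (tl xs ! 0) (\<lambda>_. Suc) (hd xs)"]
    by simp
qed

lemma recursive_triangle: "recursive n f \<Longrightarrow> recursive n (\<lambda>xs. triangle (f xs))"
proof -
  assume "recursive n f"
  moreover have "triangle k = rec_nat 0 (\<lambda>y r. r + Suc y) k" for k
    by (induction k) auto
  moreover have "recursive 2 (\<lambda>xs. xs ! 1 + Suc (xs ! 0))"
    by (intro recursive_add recursive_Suc recursive.proj) auto
  ultimately show ?thesis
    using recursive_rec_nat[of "\<lambda>y r. r + Suc y" n f 0] by simp
qed

lemma recursive_prod_encode: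
  "recursive n f \<Longrightarrow> recursive n g \<Longrightarrow> recursive n (\<lambda>xs. prod_encode (f xs, g xs))"
  unfolding prod_encode_def by (simp add: recursive_add recursive_triangle)

primrec numeral_term :: "nat \<Rightarrow> rterm"
  where
    "numeral_term 0 = Zero"
  | "numeral_term (Suc n) = Add (numeral_term n) One"

lemma term_val_numeral_term [simp]: "term_val e (numeral_term n) = of_nat n"
  by (induction n) (auto simp: add.commute)

lemma term_vars_numeral_term [simp]: "term_vars (numeral_term n) = {}"
  by (induction n) auto

lemma recursive_numeral_term: "recursive n f \<Longrightarrow> recursive n (\<lambda>xs. term_number (numeral_term (f xs)))"
proof -
  assume f: "recursive n f"
  define h :: "nat \<Rightarrow> nat \<Rightarrow> nat" where "h = (\<lambda>y r. prod_encode (3, prod_encode (r, term_number One)))"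
  have "term_number (numeral_term k) = rec_nat (term_number Zero) h k" for k
    by (induction k) (auto simp: h_def)
  moreover have "recursive 2 (\<lambda>xs. h (xs ! 0) (xs ! 1))"
    unfolding h_def by (intro recursive_prod_encode recursive_const recursive.proj) simp
  ultimately show ?thesis
    using recursive_rec_nat[of h n f "term_number Zero"] f by simp
qed

text \<open>This is substitution of a numeral for variable 0. Expressing it by a quantifier makes
  its code computable from that of \<open>\<phi>\<close> without recursion through
  \<open>\<phi>\<close>.\<close>

definition apply_form :: "rform \<Rightarrow> nat \<Rightarrow> rform"
  where "apply_form \<phi> n = FEx 0 (FAnd (FEq (Var 0) (numeral_term n)) \<phi>)"

text \<open>The diagonal function: its argument serves both as the number named by the numeral and
  as the code of the formula.\<close>

definition apply_code :: "nat \<Rightarrow> nat"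
  where "apply_code n = prod_encode (3, prod_encode (0, prod_encode (2, prod_encode
    (prod_encode (0, prod_encode (term_number (Var 0), term_number (numeral_term n))), n))))"

lemma apply_code: "form_number (apply_form \<phi> (form_number \<phi>)) = apply_code (form_number \<phi>)"
  by (simp add: apply_form_def apply_code_def)

lemma recursive_apply_code: "recursive n f \<Longrightarrow> recursive n (\<lambda>xs. apply_code (f xs))"
  unfolding apply_code_def by (intro recursive_prod_encode recursive_const recursive_numeral_term)

text \<open>Tarski's argument: a recursive truth predicate would be definable.\<close>

theorem (in definable_nats) not_decidable_theory: "\<not> decidable (first_order_theory A)"
proof
  assume "decidable (first_order_theory A)"
  then obtain f where f: "recursive 1 f"
    "\<And>x. f [x] = (if x \<in> form_number ` first_order_theory A then 1 else 0)"
    unfolding decidable_def recursive_set_def by blast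
  have "recursive 1 (\<lambda>xs. f [apply_code (xs ! 0)])"
    by (intro recursive_comp1 f recursive_apply_code recursive.proj) simp
  then have "definable 1 (\<lambda>xs. f [apply_code (xs ! 0)] = 0)"
    by (intro definable_eq recursive_imp_definable_fun definable_fun_0)
  \<comment> \<open>\<open>\<phi>\<close> says of a code in variable 0 that the formula with this
    code, applied to the code itself, is not in the theory.\<close>
  then obtain \<phi> where \<phi>: "\<And>v. sat A (of_nat \<circ> v) \<phi> \<longleftrightarrow> f [apply_code (v 0)] = 0"
    unfolding definable_def by auto
  have zero: "0 \<in> A" using of_nat_mem[of 0] by simp
  \<comment> \<open>Fixing all free variables except 0 makes the application to a numeral a
    sentence.\<close>
  obtain \<psi> where \<psi>: "free_vars \<psi> = free_vars \<phi> - (free_vars \<phi> - {0})"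
    "\<And>e. sat A e \<psi> \<longleftrightarrow> sat A (\<lambda>i. if i \<in> free_vars \<phi> - {0} then 0 else e i) \<phi>"
    using ex_form_free_vars_zero[OF zero, of "free_vars \<phi> - {0}"] finite_free_vars by blast
  define n where "n = form_number \<psi>"
  have "sat A e (apply_form \<psi> n) \<longleftrightarrow> f [apply_code n] = 0" for e
  proof -
    have "sat A e (apply_form \<psi> n) \<longleftrightarrow>
        sat A (\<lambda>i. if i \<in> free_vars \<phi> - {0} then 0 else (e(0 := of_nat n)) i) \<phi>"
      using of_nat_mem by (auto simp: apply_form_def \<psi>(2))
    also have "\<dots> \<longleftrightarrow> sat A (of_nat \<circ> (\<lambda>i. if i = 0 then n else 0)) \<phi>"
      by (rule sat_cong) auto
    finally show ?thesis by (simp add: \<phi>)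
  qed
  moreover have "free_vars (apply_form \<psi> n) = {}"
    using \<psi>(1) by (auto simp: apply_form_def)
  \<comment> \<open>The truth of the sentence is the same for every assignment; that one with values
    in \<open>A\<close> exists keeps membership in the theory from being vacuous.\<close>
  moreover have "\<exists>e :: nat \<Rightarrow> 'a. range e \<subseteq> A"
    using zero by (intro exI[of _ "\<lambda>_. 0"]) auto
  ultimately have "apply_form \<psi> n \<in> first_order_theory A \<longleftrightarrow> f [apply_code n] = 0"
    by (auto simp: first_order_theory_def)
  also have "\<dots> \<longleftrightarrow> apply_code n \<notin> form_number ` first_order_theory A"
    by (simp add: f(2))
  also have "\<dots> \<longleftrightarrow> apply_form \<psi> n \<notin> first_order_theory A"
    by (auto simp: n_def apply_code[symmetric] image_iff)
  finally show False by blast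
qed


section \<open>Integrality over a subring of the complex numbers\<close>

locale complex_subring =
  fixes R :: "complex set"
  assumes one_mem: "1 \<in> R"
    and diff_mem: "x \<in> R \<Longrightarrow> y \<in> R \<Longrightarrow> x - y \<in> R"
    and mult_mem: "x \<in> R \<Longrightarrow> y \<in> R \<Longrightarrow> x * y \<in> R"
begin

lemma zero_mem: "0 \<in> R"
  using diff_mem[OF one_mem one_mem] by simp

lemma minus_mem: "x \<in> R \<Longrightarrow> - x \<in> R"
  using diff_mem[OF zero_mem] by fastforce

lemma add_mem: "x \<in> R \<Longrightarrow> y \<in> R \<Longrightarrow> x + y \<in> R"
  using diff_mem[OF _ minus_mem, of x y] by simp

lemma sum_mem: "(\<And>i. i \<in> I \<Longrightarrow> f i \<in> R) \<Longrightarrow> sum f I \<in> R"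
  by (induction I rule: infinite_finite_induct) (auto simp: zero_mem add_mem)

lemma prod_mem: "(\<And>i. i \<in> I \<Longrightarrow> f i \<in> R) \<Longrightarrow> prod f I \<in> R"
  by (induction I rule: infinite_finite_induct) (auto simp: one_mem mult_mem)

lemma power_mem: "x \<in> R \<Longrightarrow> x ^ n \<in> R"
  by (induction n) (auto simp: one_mem mult_mem)

lemma of_nat_mem: "of_nat n \<in> R"
  by (induction n) (auto simp: zero_mem one_mem add_mem)

lemma of_int_mem: "of_int n \<in> R"
  by (cases n) (auto simp: of_nat_mem minus_mem simp del: of_nat_Suc)

section \<open>Polynomials over the subring and their roots\<close>

definition polys :: "complex poly set"
  where "polys = {p. \<forall>i. Polynomial.coeff p i \<in> R}"

lemma polysD: "p \<in> polys \<Longrightarrow> Polynomial.coeff p i \<in> R"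
  by (simp add: polys_def)

lemma polys_pCons: "a \<in> R \<Longrightarrow> p \<in> polys \<Longrightarrow> pCons a p \<in> polys"
  by (simp add: polys_def coeff_pCons split: nat.split)

lemma polys_0: "0 \<in> polys" and polys_1: "1 \<in> polys"
  by (auto simp: polys_def zero_mem one_mem)

lemma polys_add: "p \<in> polys \<Longrightarrow> q \<in> polys \<Longrightarrow> p + q \<in> polys"
  and polys_diff: "p \<in> polys \<Longrightarrow> q \<in> polys \<Longrightarrow> p - q \<in> polys"
  and polys_minus: "p \<in> polys \<Longrightarrow> - p \<in> polys"
  by (auto simp: polys_def add_mem diff_mem minus_mem)

lemma polys_mult: "p \<in> polys \<Longrightarrow> q \<in> polys \<Longrightarrow> p * q \<in> polys"
  by (auto simp: polys_def coeff_mult intro!: sum_mem mult_mem)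

lemma polys_sum: "(\<And>i. i \<in> I \<Longrightarrow> f i \<in> polys) \<Longrightarrow> sum f I \<in> polys"
  by (induction I rule: infinite_finite_induct) (auto simp: polys_0 polys_add)

lemma polys_prod: "(\<And>i. i \<in> I \<Longrightarrow> f i \<in> polys) \<Longrightarrow> prod f I \<in> polys"
  by (induction I rule: infinite_finite_induct) (auto simp: polys_1 polys_mult)

lemma char_poly_in_polys:
  assumes A: "A \<in> carrier_mat n n" and "\<And>i j. i < n \<Longrightarrow> j < n \<Longrightarrow> A $$ (i, j) \<in> R"
  shows "char_poly A \<in> polys"
proof -
  have C: "char_poly_matrix A \<in> carrier_mat n n" using A by simp
  have "char_poly_matrix A $$ (i, j) \<in> polys" if "i < n" "j < n" for i j
    using that A assms(2)[OF that]
    by (auto simp: char_poly_matrix_def intro!: polys_pCons polys_0 polys_1 minus_mem add_mem zero_mem one_mem)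
  then show ?thesis
    unfolding char_poly_def det_def'[OF C]
    by (intro polys_sum polys_mult polys_prod)
       (auto simp: sign_def polys_1 polys_minus dest: permutes_in_image)
qed

lemma poly_mem: "p \<in> polys \<Longrightarrow> x \<in> R \<Longrightarrow> poly p x \<in> R"
  unfolding poly_altdef by (intro sum_mem mult_mem power_mem polysD)

lemma polys_const: "a \<in> R \<Longrightarrow> [:a:] \<in> polys"
  by (intro polys_pCons polys_0)

lemma polys_monom: "a \<in> R \<Longrightarrow> Polynomial.monom a n \<in> polys"
  by (auto simp: polys_def zero_mem)

definition integral :: "complex \<Rightarrow> bool"
  where "integral z \<longleftrightarrow> (\<exists>p\<in>polys. lead_coeff p = 1 \<and> poly p z = 0)"

text \<open>The determinant trick: multiplication by \<open>z\<close> acts on the family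
  \<open>w\<close> through a matrix over \<open>R\<close>, so \<open>z\<close> is an eigenvalue and
  a root of the monic characteristic polynomial.\<close>

lemma integral_if_finite_module:
  assumes "finite I" and nz: "\<exists>i\<in>I. w i \<noteq> 0"
    and "\<And>i. i \<in> I \<Longrightarrow> \<exists>c. (\<forall>j\<in>I. c j \<in> R) \<and> z * w i = (\<Sum>j\<in>I. c j * w j)"
  shows "integral z"
proof -
  define n where "n = card I"
  obtain g where g: "bij_betw g {0..<n} I"
    using ex_bij_betw_nat_finite[OF assms(1)] n_def by auto
  obtain c where c: "\<And>i j. i \<in> I \<Longrightarrow> j \<in> I \<Longrightarrow> c i j \<in> R"
    "\<And>i. i \<in> I \<Longrightarrow> z * w i = (\<Sum>j\<in>I. c i j * w j)"
    using assms(3) by metis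
  define A where "A = mat n n (\<lambda>(i, j). c (g i) (g j))"
  have A: "A \<in> carrier_mat n n" by (simp add: A_def)
  have gI: "g i \<in> I" if "i < n" for i using g that by (auto simp: bij_betw_def)
  define v where "v = vec n (w \<circ> g)"
  have "A *\<^sub>v v = z \<cdot>\<^sub>v v"
  proof (rule eq_vecI)
    fix i assume "i < dim_vec (z \<cdot>\<^sub>v v)"
    then have i: "i < n" by (simp add: v_def)
    have "(A *\<^sub>v v) $ i = (\<Sum>j\<in>{0..<n}. c (g i) (g j) * w (g j))"
      using i by (simp add: A_def v_def scalar_prod_def)
    also have "\<dots> = (\<Sum>j\<in>I. c (g i) j * w j)"
      by (rule sum.reindex_bij_betw[OF g])
    also have "\<dots> = z * w (g i)" using c(2)[OF gI[OF i]] by simp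
    finally show "(A *\<^sub>v v) $ i = (z \<cdot>\<^sub>v v) $ i" using i by (simp add: v_def)
  qed (simp add: A_def v_def)
  moreover have "v \<noteq> 0\<^sub>v n"
  proof -
    obtain i where "i < n" "w (g i) \<noteq> 0" using nz g by (auto simp: bij_betw_def)
    then have "v $ i \<noteq> 0\<^sub>v n $ i" by (simp add: v_def)
    then show ?thesis by auto
  qed
  ultimately have "eigenvalue A z"
    unfolding eigenvalue_def eigenvector_def by (intro exI[of _ v]) (auto simp: A_def v_def)
  then have "poly (char_poly A) z = 0" using eigenvalue_root_char_poly[OF A] by simp
  moreover have "char_poly A \<in> polys"
    by (rule char_poly_in_polys[OF A]) (auto simp: A_def c(1) gI)
  ultimately show ?thesis
    using degree_monic_char_poly[OF A] unfolding integral_def by auto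
qed

text \<open>The products of powers of \<open>a\<close> and \<open>b\<close> with exponents below the
  degrees of their monic equations span a module stable under \<open>a\<close> and \<open>b\<close>,
  hence under their sum and product.\<close>

lemma integral_combine:
  assumes a: "integral a" and b: "integral b" and c: "c = a + b \<or> c = a * b"
  shows "integral c"
proof -
  obtain p where p: "p \<in> polys" "lead_coeff p = 1" "poly p a = 0" using a integral_def by auto
  obtain q where q: "q \<in> polys" "lead_coeff q = 1" "poly q b = 0" using b integral_def by auto
  define m where "m = Polynomial.degree p"
  define n where "n = Polynomial.degree q"
  define w where "w = (\<lambda>(i, j). a ^ i * b ^ j)"
  define I where "I = {..<m} \<times> {..<n}"
  define S where "S = {x. \<exists>c. (\<forall>k\<in>I. c k \<in> R) \<and> x = (\<Sum>k\<in>I. c k * w k)}"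
  have fin: "finite I" by (simp add: I_def)
  have S_base: "w k \<in> S" if "k \<in> I" for k
    unfolding S_def using that fin
    by (auto intro!: exI[of _ "\<lambda>l. if l = k then 1 else 0"]
        simp: zero_mem one_mem if_distrib[of "\<lambda>x. x * _"] cong: if_cong)
  have S_add: "x + y \<in> S" if "x \<in> S" "y \<in> S" for x y
    using that unfolding S_def
    by safe (rule_tac x = "\<lambda>k. c k + ca k" in exI, auto simp: add_mem ring_distribs sum.distrib)
  have S_smult: "r * x \<in> S" if "r \<in> R" "x \<in> S" for r x
    using that unfolding S_def
    by safe (rule_tac x = "\<lambda>k. r * c k" in exI, auto simp: mult_mem sum_distrib_left ac_simps)
  have S_0: "0 \<in> S" unfolding S_def by (auto intro!: exI[of _ "\<lambda>_. 0"] simp: zero_mem)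
  have S_sum: "(\<Sum>k\<in>J. f k) \<in> S" if "\<And>k. k \<in> J \<Longrightarrow> f k \<in> S" for f and J :: "'z set"
    using that by (induction J rule: infinite_finite_induct) (auto simp: S_0 S_add)
  \<comment> \<open>The monic equation expresses the first power outside the range of exponents by
    lower ones.\<close>
  have root: "z ^ Polynomial.degree r = (\<Sum>i<Polynomial.degree r. (- Polynomial.coeff r i) * z ^ i)"
    if "lead_coeff r = 1" "poly r z = 0" for r and z :: complex
    using that by (simp add: poly_altdef lessThan_Suc_atMost[symmetric] sum_negf eq_neg_iff_add_eq_0 add.commute)
  have aw: "a * w k \<in> S" if "k \<in> I" for k
  proof -
    obtain i j where k: "k = (i, j)" "i < m" "j < n" using \<open>k \<in> I\<close> by (cases k) (auto simp: I_def)
    show ?thesis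
    proof (cases "Suc i < m")
      case True
      then show ?thesis using S_base[of "(Suc i, j)"] k by (simp add: w_def I_def ac_simps)
    next
      case False
      then have "Suc i = m" using k by simp
      then have "a * w k = a ^ m * b ^ j" by (auto simp: w_def k)
      also have "\<dots> = (\<Sum>i<m. (- Polynomial.coeff p i) * w (i, j))"
        using root[OF p(2,3)] by (simp add: m_def w_def sum_distrib_right mult.assoc)
      also have "\<dots> \<in> S"
        using k by (intro S_sum S_smult minus_mem polysD p(1) S_base) (auto simp: I_def)
      finally show ?thesis .
    qed
  qed
  have bw: "b * w k \<in> S" if "k \<in> I" for k
  proof -
    obtain i j where k: "k = (i, j)" "i < m" "j < n" using \<open>k \<in> I\<close> by (cases k) (auto simp: I_def)
    show ?thesis
    proof (cases "Suc j < n")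
      case True
      then show ?thesis using S_base[of "(i, Suc j)"] k by (simp add: w_def I_def ac_simps)
    next
      case False
      then have "Suc j = n" using k by simp
      then have "b * w k = a ^ i * b ^ n" by (auto simp: w_def k)
      also have "\<dots> = (\<Sum>j<n. (- Polynomial.coeff q j) * w (i, j))"
        using root[OF q(2,3)] by (simp add: n_def w_def sum_distrib_left ac_simps)
      also have "\<dots> \<in> S"
        using k by (intro S_sum S_smult minus_mem polysD q(1) S_base) (auto simp: I_def)
      finally show ?thesis .
    qed
  qed
  have aS: "a * x \<in> S" if "x \<in> S" for x
  proof -
    obtain d where d: "\<forall>k\<in>I. d k \<in> R" "x = (\<Sum>k\<in>I. d k * w k)" using \<open>x \<in> S\<close> S_def by auto
    have "a * x = (\<Sum>k\<in>I. d k * (a * w k))" by (simp add: d(2) sum_distrib_left ac_simps)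
    also have "\<dots> \<in> S" using d(1) by (intro S_sum S_smult aw) auto
    finally show ?thesis .
  qed
  \<comment> \<open>Positive degrees put (0, 0) into \<open>I\<close>; its generator is 1, so the
    module is not zero.\<close>
  have "Polynomial.degree r > 0" if "lead_coeff r = 1" "poly r z = 0" for r and z :: complex
    using that by (auto intro!: Nat.gr0I elim!: degree_eq_zeroE)
  then have "m > 0" "n > 0" using p(2,3) q(2,3) by (auto simp: m_def n_def)
  have "c * w k \<in> S" if "k \<in> I" for k
    using c S_add[OF aw[OF that] bw[OF that]] aS[OF bw[OF that]] by (auto simp: ring_distribs mult.assoc)
  then have "\<exists>d. (\<forall>j\<in>I. d j \<in> R) \<and> c * w k = (\<Sum>j\<in>I. d j * w j)" if "k \<in> I" for k
    using that unfolding S_def by blast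
  moreover have "\<exists>k\<in>I. w k \<noteq> 0"
    using \<open>m > 0\<close> \<open>n > 0\<close> by (intro bexI[of _ "(0, 0)"]) (auto simp: w_def I_def)
  ultimately show ?thesis using integral_if_finite_module[OF fin] by blast
qed

end

section \<open>Algebraic integers and algebraic numbers as integral elements\<close>

interpretation Ints: complex_subring \<int>
  by unfold_locales auto

interpretation Rats: complex_subring \<rat>
  by unfold_locales auto

lemma algebraic_int_iff_integral: "algebraic_int z \<longleftrightarrow> Ints.integral z"
  unfolding Ints.integral_def Ints.polys_def by (auto simp: algebraic_int.simps)

lemma algebraic_iff_integral: "Polynomial.algebraic z \<longleftrightarrow> Rats.integral z"
proof
  assume "Polynomial.algebraic z"
  then obtain p where p: "p \<noteq> 0" "poly p z = 0" "\<And>i. Polynomial.coeff p i \<in> \<rat>"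
    unfolding algebraic_altdef by blast
  define q where "q = Polynomial.smult (inverse (lead_coeff p)) p"
  have "lead_coeff q = 1" "poly q z = 0" "q \<in> Rats.polys"
    using p by (auto simp: q_def Rats.polys_def)
  then show "Rats.integral z" unfolding Rats.integral_def by blast
next
  assume "Rats.integral z"
  then obtain p where "p \<in> Rats.polys" "lead_coeff p = 1" "poly p z = 0"
    unfolding Rats.integral_def by blast
  then show "Polynomial.algebraic z"
    by (intro algebraicI'[of p]) (auto simp: Rats.polys_def)
qed

lemma algebraic_int_add: "algebraic_int x \<Longrightarrow> algebraic_int y \<Longrightarrow> algebraic_int (x + y)"
  and algebraic_int_mult: "algebraic_int x \<Longrightarrow> algebraic_int y \<Longrightarrow> algebraic_int (x * y)"
  for x y :: complex
  unfolding algebraic_int_iff_integral using Ints.integral_combine by blast+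

lemma algebraic_add: "Polynomial.algebraic x \<Longrightarrow> Polynomial.algebraic y \<Longrightarrow> Polynomial.algebraic (x + y)"
  and algebraic_mult: "Polynomial.algebraic x \<Longrightarrow> Polynomial.algebraic y \<Longrightarrow> Polynomial.algebraic (x * y)"
  for x y :: complex
  unfolding algebraic_iff_integral using Rats.integral_combine by blast+

interpretation algebraic_ints: complex_subring "{z. algebraic_int z}"
proof
  fix x y :: complex
  assume "x \<in> {z. algebraic_int z}" "y \<in> {z. algebraic_int z}"
  then show "x - y \<in> {z. algebraic_int z}" "x * y \<in> {z. algebraic_int z}"
    using algebraic_int_add[of x "- y"] by (auto intro: algebraic_int_mult)
qed simp

interpretation Qbar: complex_subring Qbar
proof
  fix x y :: complex
  assume "x \<in> Qbar" "y \<in> Qbar"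
  then show "x - y \<in> Qbar" "x * y \<in> Qbar"
    using algebraic_add[of x "- y"] by (auto simp: Qbar_def intro: algebraic_mult)
qed (simp add: Qbar_def)

lemma Qbar_inverse: "x \<in> Qbar \<Longrightarrow> inverse x \<in> Qbar"
  by (auto simp: Qbar_def)

lemma Rats_subset_Qbar: "\<rat> \<subseteq> Qbar"
  by (auto simp: Qbar_def rat_imp_algebraic)


section \<open>Embeddings of the field of algebraic numbers\<close>

interpretation of_rat_poly: map_poly_inj_idom_hom "of_rat :: rat \<Rightarrow> complex" ..

lemma rat_poly_in_polys: "map_poly of_rat p \<in> Rats.polys"
  by (simp add: Rats.polys_def coeff_map_poly)

text \<open>A nonzero rational polynomial of least degree vanishing at \<open>\<alpha>\<close>
  works: in any factorisation one factor vanishes at \<open>\<alpha>\<close> and so has full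
  degree.\<close>

lemma ex_irreducible_rat_poly:
  assumes "\<alpha> \<in> Qbar"
  shows "\<exists>p :: rat poly. Factorial_Ring.irreducible p \<and> poly (map_poly of_rat p) \<alpha> = 0"
proof -
  let ?P = "\<lambda>p :: rat poly. p \<noteq> 0 \<and> poly (map_poly of_rat p) \<alpha> = 0"
  obtain p where p: "p \<noteq> 0" "poly p \<alpha> = 0" "\<And>i. Polynomial.coeff p i \<in> \<rat>"
    using assms unfolding Qbar_def mem_Collect_eq algebraic_altdef by blast
  obtain q where "p = map_poly of_rat q" using p(3) ratpolyE by blast
  then have "?P q" using p by auto
  then obtain r where r: "?P r" and min: "\<And>s. ?P s \<Longrightarrow> Polynomial.degree r \<le> Polynomial.degree s"
    using ex_has_least_nat[of ?P q Polynomial.degree] by blast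
  have "is_unit a \<or> is_unit b" if ab: "r = a * b" for a b
  proof -
    have nz: "a \<noteq> 0" "b \<noteq> 0" using r ab by auto
    have deg: "Polynomial.degree r = Polynomial.degree a + Polynomial.degree b"
      using nz by (simp add: ab degree_mult_eq)
    have "?P a \<or> ?P b" using r nz by (auto simp: ab of_rat_poly.hom_mult)
    then have "Polynomial.degree a = 0 \<or> Polynomial.degree b = 0"
      using min[of a] min[of b] deg by auto
    then show ?thesis using nz by (simp add: is_unit_iff_degree)
  qed
  moreover have "\<not> is_unit r"
  proof
    assume "is_unit r"
    then have "Polynomial.degree r = 0" using r is_unit_iff_degree by blast
    then obtain c where "r = [:c:]" by (elim degree_eq_zeroE)
    moreover have "map_poly of_rat [:c:] = ([:of_rat c:] :: complex poly)"
      by (intro poly_eqI) (simp add: coeff_map_poly coeff_pCons split: nat.split)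
    ultimately show False using r by simp
  qed
  ultimately have "Factorial_Ring.irreducible r" using r by (intro Factorial_Ring.irreducibleI) blast+
  then show ?thesis using r by blast
qed

text \<open>An irreducible polynomial vanishing at \<open>\<alpha>\<close> divides every rational
  one that does; otherwise a Bezout identity evaluated at \<open>\<alpha>\<close> would read 0 =
  1.\<close>

lemma conjugates_root:
  assumes "\<beta> \<in> conjugates \<alpha>" "p \<in> Rats.polys" "poly p \<alpha> = 0"
  shows "poly p \<beta> = 0"
proof -
  obtain r :: "rat poly" where r: "Factorial_Ring.irreducible r"
    "poly (map_poly of_rat r) \<alpha> = 0" "poly (map_poly of_rat r) \<beta> = 0"
    using assms(1) conjugates_def by auto
  obtain q where q: "p = map_poly of_rat q" using assms(2) ratpolyE Rats.polysD by blast
  have "r dvd q"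
  proof (rule ccontr)
    assume "\<not> r dvd q"
    moreover have "prime_elem r" using r(1) by (simp add: prime_elem_iff_irreducible)
    ultimately have "coprime r q" by (intro prime_elem_imp_coprime)
    then obtain a b where "a * r + b * q = 1"
      using bezout_coefficients_fst_snd[of r q] by (metis coprime_iff_gcd_eq_1)
    then have "map_poly of_rat (a * r + b * q) = (1 :: complex poly)" by simp
    then have "poly (map_poly of_rat a * map_poly of_rat r + map_poly of_rat b * p) \<alpha> = 1"
      by (simp add: of_rat_poly.hom_mult of_rat_poly.hom_add q)
    then show False using r(2) assms(3) by simp
  qed
  then show ?thesis using r(3) by (auto simp: q of_rat_poly.hom_mult)
qed

section \<open>Embeddings and their compatibility with arithmetic\<close>

text \<open>The function is total but constrained on \<open>Qbar\<close> alone; fixing 1 excludes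
  the zero map.\<close>

definition embedding :: "(complex \<Rightarrow> complex) \<Rightarrow> bool"
  where "embedding \<sigma> \<longleftrightarrow> \<sigma> 1 = 1 \<and>
    (\<forall>x\<in>Qbar. \<forall>y\<in>Qbar. \<sigma> (x + y) = \<sigma> x + \<sigma> y \<and> \<sigma> (x * y) = \<sigma> x * \<sigma> y)"

lemma embedding_add: "embedding \<sigma> \<Longrightarrow> x \<in> Qbar \<Longrightarrow> y \<in> Qbar \<Longrightarrow> \<sigma> (x + y) = \<sigma> x + \<sigma> y"
  and embedding_mult: "embedding \<sigma> \<Longrightarrow> x \<in> Qbar \<Longrightarrow> y \<in> Qbar \<Longrightarrow> \<sigma> (x * y) = \<sigma> x * \<sigma> y"
  and embedding_1: "embedding \<sigma> \<Longrightarrow> \<sigma> 1 = 1"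
  by (auto simp: embedding_def)

lemma embedding_0: "embedding \<sigma> \<Longrightarrow> \<sigma> 0 = 0"
  using embedding_add[of \<sigma> 0 0] by (simp add: Qbar.zero_mem)

lemma embedding_minus: "embedding \<sigma> \<Longrightarrow> x \<in> Qbar \<Longrightarrow> \<sigma> (- x) = - \<sigma> x"
  using embedding_add[of \<sigma> x "- x"]
  by (simp add: Qbar.minus_mem embedding_0 eq_neg_iff_add_eq_0 add.commute)

lemma embedding_diff: "embedding \<sigma> \<Longrightarrow> x \<in> Qbar \<Longrightarrow> y \<in> Qbar \<Longrightarrow> \<sigma> (x - y) = \<sigma> x - \<sigma> y"
  using embedding_add[of \<sigma> x "- y"] by (simp add: Qbar.minus_mem embedding_minus)

lemma embedding_power: "embedding \<sigma> \<Longrightarrow> x \<in> Qbar \<Longrightarrow> \<sigma> (x ^ n) = \<sigma> x ^ n"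
  by (induction n) (auto simp: embedding_1 embedding_mult Qbar.power_mem)

lemma embedding_sum:
  "embedding \<sigma> \<Longrightarrow> (\<And>i. i \<in> I \<Longrightarrow> f i \<in> Qbar) \<Longrightarrow> \<sigma> (sum f I) = (\<Sum>i\<in>I. \<sigma> (f i))"
  by (induction I rule: infinite_finite_induct) (auto simp: embedding_0 embedding_add Qbar.sum_mem)

lemma embedding_prod:
  "embedding \<sigma> \<Longrightarrow> (\<And>i. i \<in> I \<Longrightarrow> f i \<in> Qbar) \<Longrightarrow> \<sigma> (prod f I) = (\<Prod>i\<in>I. \<sigma> (f i))"
  by (induction I rule: infinite_finite_induct) (auto simp: embedding_1 embedding_mult Qbar.prod_mem)

lemma embedding_of_nat: "embedding \<sigma> \<Longrightarrow> \<sigma> (of_nat n) = of_nat n"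
  by (induction n) (auto simp: embedding_0 embedding_1 embedding_add Qbar.one_mem Qbar.of_nat_mem)

lemma embedding_numeral: "embedding \<sigma> \<Longrightarrow> \<sigma> (numeral n) = numeral n"
  using embedding_of_nat[of \<sigma> "numeral n"] by simp

lemma embedding_of_int: "embedding \<sigma> \<Longrightarrow> \<sigma> (of_int n) = of_int n"
  by (cases n) (auto simp: embedding_of_nat embedding_minus Qbar.of_nat_mem simp del: of_nat_Suc)

lemma embedding_nonzero:
  assumes "embedding \<sigma>" "x \<in> Qbar" "x \<noteq> 0"
  shows "\<sigma> x \<noteq> 0"
  using embedding_mult[OF assms(1,2) Qbar_inverse[OF assms(2)]] assms by (auto simp: embedding_1)

lemma embedding_inverse:
  assumes "embedding \<sigma>" "x \<in> Qbar"
  shows "\<sigma> (inverse x) = inverse (\<sigma> x)"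
proof (cases "x = 0")
  case False
  then have "\<sigma> x * \<sigma> (inverse x) = 1"
    using embedding_mult[OF assms Qbar_inverse[OF assms(2)]] assms by (simp add: embedding_1)
  then show ?thesis by (metis inverse_unique)
qed (simp add: embedding_0 assms)

lemma embedding_Rats:
  assumes "embedding \<sigma>" "r \<in> \<rat>"
  shows "\<sigma> r = r"
proof -
  obtain a b where "r = of_int a / of_int b" using assms(2) by (elim Rats_cases')
  then show ?thesis
    using assms(1) by (simp add: divide_inverse embedding_mult embedding_inverse embedding_of_int
        Qbar.of_int_mem Qbar_inverse)
qed

lemma embedding_poly:
  assumes "embedding \<sigma>" "p \<in> Rats.polys" "x \<in> Qbar"
  shows "poly p (\<sigma> x) = \<sigma> (poly p x)"
proof -
  have c: "Polynomial.coeff p i \<in> Qbar" for i using assms(2) Rats.polysD Rats_subset_Qbar by blast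
  have "\<sigma> (poly p x) = (\<Sum>i\<le>Polynomial.degree p. \<sigma> (Polynomial.coeff p i) * \<sigma> x ^ i)"
    using assms c
    by (simp add: poly_altdef embedding_sum embedding_mult embedding_power Qbar.mult_mem Qbar.power_mem)
  also have "\<dots> = poly p (\<sigma> x)"
    using assms(2) by (simp add: poly_altdef embedding_Rats[OF assms(1)] Rats.polysD)
  finally show ?thesis by simp
qed

lemma embedding_conjugates:
  assumes "embedding \<sigma>" "x \<in> Qbar" shows "\<sigma> x \<in> conjugates x"
proof -
  obtain p :: "rat poly" where "Factorial_Ring.irreducible p" "poly (map_poly of_rat p) x = 0"
    using ex_irreducible_rat_poly[OF assms(2)] by blast
  then show ?thesis
    using embedding_poly[OF assms(1) rat_poly_in_polys assms(2), of p] embedding_0[OF assms(1)]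
    by (auto simp: conjugates_def)
qed

lemma embedding_algebraic_int:
  assumes "embedding \<sigma>" "algebraic_int x" shows "algebraic_int (\<sigma> x)"
proof -
  have x: "x \<in> Qbar" using assms(2) by (auto simp: Qbar_def)
  obtain p where p: "p \<in> Ints.polys" "lead_coeff p = 1" "poly p x = 0"
    using assms(2) unfolding algebraic_int_iff_integral Ints.integral_def by blast
  then have "p \<in> Rats.polys" by (auto simp: Rats.polys_def Ints.polys_def Ints_subset_Rats[THEN subsetD])
  then have "poly p (\<sigma> x) = 0" using embedding_poly[OF assms(1) _ x] p embedding_0[OF assms(1)] by simp
  then show ?thesis using p unfolding algebraic_int_iff_integral Ints.integral_def by blast
qed

text \<open>Partial embeddings are represented by their graphs, so that Zorn's lemma applies to inclusion.\<close>

definition hom_graph :: "(complex \<times> complex) set \<Rightarrow> bool"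
  where "hom_graph G \<longleftrightarrow> single_valued G \<and> (\<forall>r\<in>\<rat>. (r, r) \<in> G) \<and> Domain G \<subseteq> Qbar \<and>
    (\<forall>x y x' y'. (x, y) \<in> G \<longrightarrow> (x', y') \<in> G \<longrightarrow> (x + x', y + y') \<in> G \<and> (x * x', y * y') \<in> G)"

text \<open>One algebraic step: \<open>z\<close> goes to a root of the image of its minimal
  polynomial over the domain, and polynomial expressions in \<open>z\<close> follow.\<close>

lemma hom_graph_extend:
  assumes G: "hom_graph G" and z: "z \<in> Qbar"
  shows "\<exists>G'. hom_graph G' \<and> G \<subseteq> G' \<and> z \<in> Domain G'"
proof -
  define F where "F = Domain G"
  have sv: "(x, y) \<in> G \<Longrightarrow> (x, y') \<in> G \<Longrightarrow> y = y'" for x y y'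
    using G by (auto simp: hom_graph_def single_valued_def)
  have rat: "r \<in> \<rat> \<Longrightarrow> (r, r) \<in> G" for r using G by (auto simp: hom_graph_def)
  have add: "(x, y) \<in> G \<Longrightarrow> (x', y') \<in> G \<Longrightarrow> (x + x', y + y') \<in> G"
    and mult: "(x, y) \<in> G \<Longrightarrow> (x', y') \<in> G \<Longrightarrow> (x * x', y * y') \<in> G" for x x' y y'
    using G by (auto simp: hom_graph_def)
  have FQ: "F \<subseteq> Qbar" using G by (auto simp: hom_graph_def F_def)
  have neg: "(x, y) \<in> G \<Longrightarrow> (- x, - y) \<in> G" for x y
    using mult[of "-1" "-1" x y] rat[of "-1"] by simp
  interpret F: complex_subring F
  proof
    show "1 \<in> F" using rat[of 1] by (auto simp: F_def)
    show "x * y \<in> F" if "x \<in> F" "y \<in> F" for x y using that mult unfolding F_def by blast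
    show "x - y \<in> F" if "x \<in> F" "y \<in> F" for x y
      using that add neg unfolding F_def by (metis Domain.cases Domain.intros diff_conv_add_uminus)
  qed
  have RF: "\<rat> \<subseteq> F" using rat by (auto simp: F_def)
  define \<sigma> where "\<sigma> x = (THE y. (x, y) \<in> G)" for x
  have \<sigma>: "(x, y) \<in> G \<longleftrightarrow> x \<in> F \<and> y = \<sigma> x" for x y
    unfolding \<sigma>_def F_def using sv by (auto intro: theI2)
  have \<sigma>_add: "x \<in> F \<Longrightarrow> y \<in> F \<Longrightarrow> \<sigma> (x + y) = \<sigma> x + \<sigma> y"
    and \<sigma>_mult: "x \<in> F \<Longrightarrow> y \<in> F \<Longrightarrow> \<sigma> (x * y) = \<sigma> x * \<sigma> y" for x y
    using add[of x "\<sigma> x" y "\<sigma> y"] mult[of x "\<sigma> x" y "\<sigma> y"] \<sigma> by auto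
  have \<sigma>_0: "\<sigma> 0 = 0" and \<sigma>_1: "\<sigma> 1 = 1" using rat[of 0] rat[of 1] \<sigma> by auto
  have \<sigma>_neg: "x \<in> F \<Longrightarrow> \<sigma> (- x) = - \<sigma> x" for x using neg[of x "\<sigma> x"] \<sigma> by auto
  have \<sigma>_sum: "(\<And>i. i \<in> I \<Longrightarrow> f i \<in> F) \<Longrightarrow> \<sigma> (sum f I) = (\<Sum>i\<in>I. \<sigma> (f i))" for f and I :: "nat set"
    by (induction I rule: infinite_finite_induct) (auto simp: \<sigma>_0 \<sigma>_add F.sum_mem)
  \<comment> \<open>The domain is a field: an integer polynomial with nonzero constant term
    vanishing at \<open>x\<close> can be solved for the inverse of \<open>x\<close>.\<close>
  have F_inverse: "inverse x \<in> F" if "x \<in> F" for x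
  proof (cases "x = 0")
    case False
    have "Polynomial.algebraic x" using that FQ by (auto simp: Qbar_def)
    then obtain p where p: "Polynomial.coeff p 0 \<noteq> 0" "poly (map_poly of_int p) x = 0"
      using False by (rule algebraicE'_nonzero)
    obtain c q where cq: "p = pCons c q" by (cases p)
    have "of_int c + x * poly (map_poly of_int q) x = 0" using p by (simp add: cq map_poly_pCons)
    then have "inverse x = - poly (map_poly of_int q) x * inverse (of_int c)"
      using False p(1) by (simp add: cq field_simps add_eq_0_iff)
    moreover have "map_poly of_int q \<in> F.polys"
      by (simp add: F.polys_def coeff_map_poly F.of_int_mem)
    then have "poly (map_poly of_int q) x \<in> F" using that by (rule F.poly_mem)
    moreover have "inverse (of_int c) \<in> F" using RF by auto
    ultimately show ?thesis by (simp add: F.mult_mem F.minus_mem)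
  qed (simp add: F.zero_mem)
  have \<sigma>_nonzero: "\<sigma> x \<noteq> 0" if "x \<in> F" "x \<noteq> 0" for x
    using \<sigma>_mult[OF that(1) F_inverse[OF that(1)]] that \<sigma>_1 by auto
  define H where "H = map_poly \<sigma>"
  have coeff_H: "Polynomial.coeff (H p) i = \<sigma> (Polynomial.coeff p i)" for p i
    by (simp add: H_def coeff_map_poly \<sigma>_0)
  have H_add: "H (p + q) = H p + H q" if "p \<in> F.polys" "q \<in> F.polys" for p q
    using that by (intro poly_eqI) (simp add: coeff_H \<sigma>_add F.polysD)
  have H_neg: "H (- p) = - H p" if "p \<in> F.polys" for p
    using that by (intro poly_eqI) (simp add: coeff_H \<sigma>_neg F.polysD)
  have H_mult: "H (p * q) = H p * H q" if "p \<in> F.polys" "q \<in> F.polys" for p q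
    using that by (intro poly_eqI)
      (simp add: coeff_H coeff_mult \<sigma>_sum \<sigma>_mult F.polysD F.mult_mem)
  have H_diff: "H (p - q) = H p - H q" if "p \<in> F.polys" "q \<in> F.polys" for p q
    using H_add[OF that(1) F.polys_minus[OF that(2)]] H_neg[OF that(2)] by simp
  have H_pCons: "H (pCons a p) = pCons (\<sigma> a) (H p)" for a p
    by (intro poly_eqI) (simp add: coeff_H coeff_pCons split: nat.split)
  have H_0: "H 0 = 0" by (simp add: H_def)
  \<comment> \<open>A polynomial \<open>m\<close> of least degree with this property is, up to a
    factor, the minimal polynomial of \<open>z\<close> over the domain.\<close>
  let ?P = "\<lambda>p. p \<in> F.polys \<and> p \<noteq> 0 \<and> poly p z = 0"
  obtain p0 where "p0 \<noteq> 0" "poly p0 z = 0" "\<And>i. Polynomial.coeff p0 i \<in> \<rat>"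
    using z unfolding Qbar_def mem_Collect_eq algebraic_altdef by blast
  then have "?P p0" using RF by (auto simp: F.polys_def)
  then obtain m where m: "?P m" and min: "\<And>p. ?P p \<Longrightarrow> Polynomial.degree m \<le> Polynomial.degree p"
    using ex_has_least_nat[of ?P p0 Polynomial.degree] by blast
  have deg_m: "Polynomial.degree m > 0" using m by (auto intro!: Nat.gr0I elim!: degree_eq_zeroE)
  \<comment> \<open>The leading coefficient survives \<open>\<sigma>\<close>, so the image of
    \<open>m\<close> is not constant and has a complex root.\<close>
  have "Polynomial.coeff (H m) (Polynomial.degree m) \<noteq> 0"
    unfolding coeff_H using m by (intro \<sigma>_nonzero F.polysD) auto
  then have "Polynomial.degree (H m) > 0" using deg_m le_degree[of "H m" "Polynomial.degree m"] by simp
  then obtain w where w: "poly (H m) w = 0"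
    using fundamental_theorem_of_algebra[of "H m"] constant_degree[of "H m"] by auto
  \<comment> \<open>Division by \<open>m\<close>, one leading term at a time, shows this; it makes
    the value at a polynomial expression in \<open>z\<close> independent of the polynomial
    chosen.\<close>
  have key: "poly (H p) w = 0" if "p \<in> F.polys" "poly p z = 0" for p
    using that
  proof (induction "Polynomial.degree p" arbitrary: p rule: less_induct)
    case less
    show ?case
    proof (cases "p = 0")
      case False
      then have le: "Polynomial.degree m \<le> Polynomial.degree p" using min less.prems by blast
      define c where "c = lead_coeff p * inverse (lead_coeff m)"
      define t where "t = Polynomial.monom c (Polynomial.degree p - Polynomial.degree m)"
      have c: "c \<in> F" unfolding c_def using less.prems(1) m by (intro F.mult_mem F_inverse F.polysD) auto
      have t: "t \<in> F.polys" unfolding t_def using c by (rule F.polys_monom)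
      have "c \<noteq> 0" using False m by (simp add: c_def)
      then have deg_t: "Polynomial.degree (t * m) = Polynomial.degree p"
        using le m by (subst degree_mult_eq) (auto simp: t_def degree_monom_eq)
      have lead: "Polynomial.coeff (t * m) (Polynomial.degree p) = lead_coeff p"
        using le m by (simp add: t_def coeff_monom_mult c_def)
      define q where "q = p - t * m"
      have q: "q \<in> F.polys" unfolding q_def using less.prems(1) m t by (intro F.polys_diff F.polys_mult) auto
      have qz: "poly q z = 0" using less.prems(2) m by (simp add: q_def)
      have "poly (H q) w = 0"
      proof (cases "q = 0")
        case False
        have "Polynomial.degree q \<le> Polynomial.degree p"
          unfolding q_def using deg_t by (intro degree_diff_le) auto
        moreover have "Polynomial.coeff q (Polynomial.degree p) = 0" by (simp add: q_def lead)
        then have "Polynomial.degree q \<noteq> Polynomial.degree p" using False by (metis leading_coeff_0_iff)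
        ultimately show ?thesis using less.hyps[OF _ q qz] by simp
      qed (simp add: H_0)
      moreover have "p = q + t * m" by (simp add: q_def)
      then have "H p = H q + H t * H m"
        using q t m by (simp add: H_add H_mult F.polys_mult)
      ultimately show ?thesis using w by simp
    qed (simp add: H_0)
  qed
  define G' where "G' = {(poly p z, poly (H p) w) | p. p \<in> F.polys}"
  have "hom_graph G'"
    unfolding hom_graph_def
  proof (intro conjI ballI allI impI)
    show "single_valued G'"
    proof (rule single_valuedI)
      fix x y y' assume "(x, y) \<in> G'" "(x, y') \<in> G'"
      then obtain p q where pq: "p \<in> F.polys" "q \<in> F.polys" "x = poly p z" "x = poly q z"
        "y = poly (H p) w" "y' = poly (H q) w" unfolding G'_def by auto
      then show "y = y'" using key[OF F.polys_diff[OF pq(1,2)]] by (simp add: H_diff)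
    qed
    show "(r, r) \<in> G'" if "r \<in> \<rat>" for r
      using that RF rat[OF that] \<sigma> unfolding G'_def
      by (auto intro!: exI[of _ "[:r:]"] F.polys_const simp: H_pCons H_0)
    show "Domain G' \<subseteq> Qbar"
      using z FQ by (auto simp: G'_def Qbar.polys_def F.polys_def subset_iff intro!: Qbar.poly_mem)
  next
    fix x y x' y' assume "(x, y) \<in> G'" "(x', y') \<in> G'"
    then obtain p q where pq: "p \<in> F.polys" "q \<in> F.polys" "x = poly p z" "x' = poly q z"
      "y = poly (H p) w" "y' = poly (H q) w" unfolding G'_def by auto
    then show "(x + x', y + y') \<in> G'" "(x * x', y * y') \<in> G'"
      unfolding G'_def mem_Collect_eq using F.polys_add[of p q] F.polys_mult[of p q]
      by (metis poly_add H_add, metis poly_mult H_mult)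
  qed
  moreover have "G \<subseteq> G'"
    using \<sigma> unfolding G'_def
    by (auto intro!: exI[of _ "[:_:]"] F.polys_const simp: H_pCons H_0)
  moreover have "(z, w) \<in> G'"
    unfolding G'_def
    by (auto intro!: exI[of _ "[:0, 1:]"] F.polys_pCons F.polys_0 F.zero_mem F.one_mem
        simp: H_pCons H_0 \<sigma>_0 \<sigma>_1)
  ultimately show ?thesis by blast
qed

text \<open>Sending p(\<alpha>) to p(\<beta>) for rational p is well defined by
  \<open>conjugates_root\<close>. A maximal extension, from Zorn's lemma, is defined on all of
  \<open>Qbar\<close>, since \<open>hom_graph_extend\<close> would enlarge it otherwise.\<close>

lemma ex_embedding:
  assumes "\<alpha> \<in> Qbar" "\<beta> \<in> conjugates \<alpha>"
  shows "\<exists>\<sigma>. embedding \<sigma> \<and> \<sigma> \<alpha> = \<beta>"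
proof -
  define G0 where "G0 = {(poly p \<alpha>, poly p \<beta>) | p. p \<in> Rats.polys}"
  have G0: "hom_graph G0"
    unfolding hom_graph_def
  proof (intro conjI ballI allI impI)
    show "single_valued G0"
    proof (rule single_valuedI)
      fix x y y' assume "(x, y) \<in> G0" "(x, y') \<in> G0"
      then obtain p q where pq: "p \<in> Rats.polys" "q \<in> Rats.polys" "x = poly p \<alpha>" "x = poly q \<alpha>"
        "y = poly p \<beta>" "y' = poly q \<beta>" unfolding G0_def by auto
      then show "y = y'" using conjugates_root[OF assms(2) Rats.polys_diff[OF pq(1,2)]] by simp
    qed
    show "(r, r) \<in> G0" if "r \<in> \<rat>" for r
      using that unfolding G0_def by (auto intro!: exI[of _ "[:r:]"] Rats.polys_const)
    show "Domain G0 \<subseteq> Qbar"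
      using assms(1) Rats_subset_Qbar
      by (auto simp: G0_def Qbar.polys_def Rats.polys_def subset_iff intro!: Qbar.poly_mem)
  next
    fix x y x' y' assume "(x, y) \<in> G0" "(x', y') \<in> G0"
    then obtain p q where "p \<in> Rats.polys" "q \<in> Rats.polys" "x = poly p \<alpha>" "x' = poly q \<alpha>"
      "y = poly p \<beta>" "y' = poly q \<beta>" unfolding G0_def by auto
    then show "(x + x', y + y') \<in> G0" "(x * x', y * y') \<in> G0"
      unfolding G0_def mem_Collect_eq using Rats.polys_add[of p q] Rats.polys_mult[of p q]
      by (metis poly_add, metis poly_mult)
  qed
  define \<A> where "\<A> = {G. hom_graph G \<and> G0 \<subseteq> G}"
  have "\<Union>\<C> \<in> \<A>" if ne: "\<C> \<noteq> {}" and ch: "subset.chain \<A> \<C>" for \<C>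
  proof -
    have sub: "\<C> \<subseteq> \<A>" using ch by (simp add: subset.chain_def)
    \<comment> \<open>Any two pairs in the union of a chain lie in a common member, so the closure
      conditions pass to the union.\<close>
    have pair: "\<exists>G\<in>\<C>. u \<in> G \<and> v \<in> G" if uv: "u \<in> \<Union>\<C>" "v \<in> \<Union>\<C>" for u v
    proof -
      obtain A B where "A \<in> \<C>" "u \<in> A" "B \<in> \<C>" "v \<in> B" using uv by blast
      moreover have "A \<subseteq> B \<or> B \<subseteq> A"
        using ch \<open>A \<in> \<C>\<close> \<open>B \<in> \<C>\<close> by (auto simp: subset_chain_def)
      ultimately show ?thesis by blast
    qed
    have hg: "hom_graph G" "G0 \<subseteq> G" if "G \<in> \<C>" for G using that sub by (auto simp: \<A>_def)
    have "hom_graph (\<Union>\<C>)"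
      unfolding hom_graph_def
    proof (intro conjI ballI allI impI)
      show "single_valued (\<Union>\<C>)"
      proof (rule single_valuedI)
        fix x y y' assume "(x, y) \<in> \<Union>\<C>" "(x, y') \<in> \<Union>\<C>"
        from pair[OF this] show "y = y'"
          using hg(1) unfolding hom_graph_def single_valued_def by blast
      qed
      show "(r, r) \<in> \<Union>\<C>" if "r \<in> \<rat>" for r
        using that ne hg(1) unfolding hom_graph_def by blast
      show "Domain (\<Union>\<C>) \<subseteq> Qbar"
        using hg(1) unfolding hom_graph_def by blast
    next
      fix x y x' y' assume "(x, y) \<in> \<Union>\<C>" "(x', y') \<in> \<Union>\<C>"
      from pair[OF this] obtain G where "G \<in> \<C>" "(x, y) \<in> G" "(x', y') \<in> G" by blast
      then show "(x + x', y + y') \<in> \<Union>\<C>" "(x * x', y * y') \<in> \<Union>\<C>"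
        using hg(1)[of G] unfolding hom_graph_def by blast+
    qed
    then show ?thesis using ne hg(2) by (auto simp: \<A>_def)
  qed
  moreover have "\<A> \<noteq> {}" using G0 by (auto simp: \<A>_def)
  ultimately obtain M where M: "M \<in> \<A>" and max: "\<And>Y. Y \<in> \<A> \<Longrightarrow> M \<subseteq> Y \<Longrightarrow> Y = M"
    using subset_Zorn_nonempty[of \<A>] by blast
  have hM: "hom_graph M" "G0 \<subseteq> M" using M by (auto simp: \<A>_def)
  have dom: "z \<in> Domain M" if z: "z \<in> Qbar" for z
  proof -
    obtain Y where Y: "hom_graph Y" "M \<subseteq> Y" "z \<in> Domain Y"
      using hom_graph_extend[OF hM(1) z] by blast
    then have "Y = M" using hM(2) by (intro max) (auto simp: \<A>_def)
    then show ?thesis using Y(3) by simp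
  qed
  define \<sigma> where "\<sigma> x = (THE y. (x, y) \<in> M)" for x
  have \<sigma>: "y = \<sigma> x" if "(x, y) \<in> M" for x y
    unfolding \<sigma>_def using that hM(1)
    by (intro the_equality[symmetric]) (auto simp: hom_graph_def single_valued_def)
  have M\<sigma>: "(x, \<sigma> x) \<in> M" if "x \<in> Qbar" for x using dom[OF that] \<sigma> by blast
  have add: "(x, y) \<in> M \<Longrightarrow> (x', y') \<in> M \<Longrightarrow> (x + x', y + y') \<in> M"
    and mult: "(x, y) \<in> M \<Longrightarrow> (x', y') \<in> M \<Longrightarrow> (x * x', y * y') \<in> M" for x x' y y'
    using hM(1) by (auto simp: hom_graph_def)
  have "embedding \<sigma>"
    unfolding embedding_def
  proof (intro conjI ballI)
    have "(1, 1) \<in> M" using hM(1) by (auto simp: hom_graph_def)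
    then show "\<sigma> 1 = 1" using \<sigma> by metis
  next
    fix x y assume "x \<in> Qbar" "y \<in> Qbar"
    then show "\<sigma> (x + y) = \<sigma> x + \<sigma> y" "\<sigma> (x * y) = \<sigma> x * \<sigma> y"
      using \<sigma>[OF add[OF M\<sigma> M\<sigma>]] \<sigma>[OF mult[OF M\<sigma> M\<sigma>]] by metis+
  qed
  moreover have "(\<alpha>, \<beta>) \<in> G0"
    unfolding G0_def by (auto intro!: exI[of _ "[:0, 1:]"] Rats.polys_pCons Rats.polys_0)
  then have "\<sigma> \<alpha> = \<beta>" using hM(2) \<sigma> by (metis subsetD)
  ultimately show ?thesis by blast
qed

text \<open>The images of an algebraic number under embeddings are exactly its conjugates.\<close>

lemma totally_real_iff_embedding:
  "totally_real \<alpha> \<longleftrightarrow> \<alpha> \<in> Qbar \<and> (\<forall>\<sigma>. embedding \<sigma> \<longrightarrow> \<sigma> \<alpha> \<in> \<real>)"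
proof
  assume "totally_real \<alpha>"
  then show "\<alpha> \<in> Qbar \<and> (\<forall>\<sigma>. embedding \<sigma> \<longrightarrow> \<sigma> \<alpha> \<in> \<real>)"
    using embedding_conjugates[of _ \<alpha>] by (auto simp: totally_real_def Qbar_def Reals_def)
next
  assume "\<alpha> \<in> Qbar \<and> (\<forall>\<sigma>. embedding \<sigma> \<longrightarrow> \<sigma> \<alpha> \<in> \<real>)"
  then show "totally_real \<alpha>"
    using ex_embedding[of \<alpha>] by (fastforce simp: totally_real_def Qbar_def Reals_def)
qed

text \<open>A norm argument: up to sign, the product of the conjugates is rational and integral,
  hence an integer; for nonzero \<open>y\<close> it would be nonzero and of absolute value below
  1.\<close>

lemma algebraic_int_small_eq_0:
  assumes y: "algebraic_int y" and small: "\<And>\<sigma>. embedding \<sigma> \<Longrightarrow> norm (\<sigma> y) < 1"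
  shows "y = 0"
proof (rule ccontr)
  assume nz: "y \<noteq> 0"
  have yQ: "y \<in> Qbar" using y by (auto simp: Qbar_def)
  obtain p :: "rat poly" where p: "Factorial_Ring.irreducible p" "poly (map_poly of_rat p) y = 0"
    using ex_irreducible_rat_poly[OF yQ] by blast
  define P where "P = map_poly (of_rat :: rat \<Rightarrow> complex) p"
  have P0: "P \<noteq> 0" using p(1) by (auto simp: P_def)
  have root: "algebraic_int z" "norm z < 1" "z \<noteq> 0" if "poly P z = 0" for z
  proof -
    have "z \<in> conjugates y" using p that by (auto simp: conjugates_def P_def)
    then obtain \<sigma> where "embedding \<sigma>" "\<sigma> y = z" using ex_embedding[OF yQ] by blast
    then show "algebraic_int z" "norm z < 1" "z \<noteq> 0"
      using small embedding_algebraic_int[OF _ y] embedding_nonzero[OF _ yQ nz] by auto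
  qed
  let ?Z = "{z. poly P z = 0}"
  \<comment> \<open>Counting roots with multiplicity makes \<open>c\<close> equal to
    \<open>poly P 0 / lead_coeff P\<close> whether or not the roots are simple.\<close>
  define c where "c = (\<Prod>z\<in>?Z. (- z) ^ Polynomial.order z P)"
  have fin: "finite ?Z" using P0 by (rule poly_roots_finite)
  have "poly P 0 = lead_coeff P * c"
    by (subst complex_poly_decompose[of P, symmetric]) (simp add: c_def poly_prod)
  then have "c = poly P 0 / lead_coeff P" using P0 by simp
  then have "c \<in> \<rat>" by (simp add: P_def poly_0_coeff_0 coeff_map_poly)
  moreover have "algebraic_int c"
  proof -
    have "(- z) ^ Polynomial.order z P \<in> {z. algebraic_int z}" if "z \<in> ?Z" for z
      using that root(1) by (intro algebraic_ints.power_mem) auto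
    from algebraic_ints.prod_mem[of ?Z "\<lambda>z. (- z) ^ Polynomial.order z P", OF this]
    show ?thesis unfolding c_def by (rule CollectD)
  qed
  ultimately have "c \<in> \<int>" by (intro rational_algebraic_int_is_int)
  have "c \<noteq> 0" using fin root(3) by (auto simp: c_def)
  have "norm c = (\<Prod>z\<in>?Z. norm z ^ Polynomial.order z P)"
    by (simp add: c_def prod_norm[symmetric] norm_power)
  also have "\<dots> < 1"
  proof -
    have yZ: "y \<in> ?Z" using p(2) by (simp add: P_def)
    have "norm y ^ Polynomial.order y P < 1"
      using root(2)[of y] yZ P0 by (intro power_less_one_iff[THEN iffD2]) (auto simp: order_root)
    moreover have "(\<Prod>z\<in>?Z - {y}. norm z ^ Polynomial.order z P) \<le> 1"
      using root(2) by (intro prod_le_1) (auto intro!: power_le_one simp: less_imp_le)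
    moreover have "(\<Prod>z\<in>?Z - {y}. norm z ^ Polynomial.order z P) \<ge> 0"
      by (intro prod_nonneg) auto
    ultimately have "norm y ^ Polynomial.order y P * (\<Prod>z\<in>?Z - {y}. norm z ^ Polynomial.order z P) < 1"
      by (metis le_less_trans mult_left_le mult.right_neutral norm_ge_zero zero_le_power)
    then show ?thesis using prod.remove[OF fin yZ, of "\<lambda>z. norm z ^ Polynomial.order z P"] by simp
  qed
  finally show False using \<open>c \<in> \<int>\<close> \<open>c \<noteq> 0\<close> by (auto elim!: Ints_cases)
qed


section \<open>Definability of the natural numbers in a CM field\<close>

text \<open>Modulo \<open>q = 1 + g x\<^sup>2\<close> one has \<open>i\<^sup>2 - x\<^sup>2 = q i\<^sup>2 - (1 + g i\<^sup>2) x\<^sup>2\<close>.\<close>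

lemma (in complex_subring) prod_square_diff_mod:
  assumes "x \<in> R" "g \<in> R"
  shows "\<exists>c\<in>R. (\<Prod>i\<le>n. of_nat i ^ 2 - x ^ 2) =
    (1 + g * x ^ 2) * c + (- (x ^ 2)) ^ Suc n * (\<Prod>i\<le>n. 1 + g * of_nat i ^ 2)"
proof (induction n)
  case 0
  then show ?case by (intro bexI[of _ 0]) (auto simp: zero_mem)
next
  case (Suc n)
  let ?q = "1 + g * x ^ 2" and ?i = "of_nat (Suc n) :: complex"
  let ?r = "(- (x ^ 2)) ^ Suc n * (\<Prod>i\<le>n. 1 + g * of_nat i ^ 2)"
  obtain c where c: "c \<in> R" "(\<Prod>i\<le>n. of_nat i ^ 2 - x ^ 2) = ?q * c + ?r" using Suc by blast
  have "?i ^ 2 - x ^ 2 = ?q * ?i ^ 2 - (1 + g * ?i ^ 2) * x ^ 2" by (simp add: algebra_simps)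
  then have "(\<Prod>i\<le>Suc n. of_nat i ^ 2 - x ^ 2) =
      (?q * c + ?r) * (?q * ?i ^ 2 - (1 + g * ?i ^ 2) * x ^ 2)"
    using c(2) by simp
  also have "\<dots> = ?q * (c * (?i ^ 2 - x ^ 2) + ?r * ?i ^ 2) +
      (- (x ^ 2)) ^ Suc (Suc n) * (\<Prod>i\<le>Suc n. 1 + g * of_nat i ^ 2)"
    by (simp del: of_nat_Suc power_Suc add: power_Suc[of _ "Suc n"])
      (simp only: algebra_simps mult_1_left mult_1_right)
  finally show ?case
    using assms c(1)
    by (intro bexI[of _ "c * (?i ^ 2 - x ^ 2) + ?r * ?i ^ 2"])
       (auto intro!: add_mem mult_mem diff_mem power_mem prod_mem of_nat_mem minus_mem one_mem simp del: of_nat_Suc)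
qed

text \<open>All images of \<open>f\<close> are among the finitely many roots of one rational
  polynomial.\<close>

lemma bounded_embeddings:
  assumes "f \<in> Qbar"
  shows "\<exists>B. \<forall>\<sigma>. embedding \<sigma> \<longrightarrow> norm (\<sigma> f) \<le> B"
proof -
  obtain p where p: "p \<noteq> 0" "poly p f = 0" "\<And>i. Polynomial.coeff p i \<in> \<rat>"
    using assms unfolding Qbar_def mem_Collect_eq algebraic_altdef by blast
  define B where "B = Max (norm ` {z. poly p z = 0})"
  have "finite {z. poly p z = 0}" using p(1) by (rule poly_roots_finite)
  then have B: "norm z \<le> B" if "poly p z = 0" for z
    unfolding B_def using that by (intro Max_ge) auto
  have "poly p (\<sigma> f) = 0" if "embedding \<sigma>" for \<sigma>
    using embedding_poly[OF that, of p f] assms p embedding_0[OF that] by (simp add: Rats.polys_def)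
  then show ?thesis using B by blast
qed

section \<open>CM fields, possibly of infinite degree, containing the square roots of all
  naturals\<close>

text \<open>Commutation of \<open>cnj\<close> with every embedding is the CM property that forces
  suitable units to be real; the square roots supply the units needed to reach all integers.\<close>

locale cm_field =
  fixes L :: "complex set"
  assumes subring_L: "complex_subring L"
    and L_subset: "L \<subseteq> Qbar"
    and cnj_L: "x \<in> L \<Longrightarrow> cnj x \<in> L"
    and embedding_cnj: "embedding \<sigma> \<Longrightarrow> x \<in> L \<Longrightarrow> \<sigma> (cnj x) = cnj (\<sigma> x)"
    and sqrt_L: "complex_of_real (sqrt (of_nat m)) \<in> L"
begin

abbreviation OL where "OL \<equiv> ring_of_integers L"

sublocale OL: complex_subring OL
proof -
  interpret L: complex_subring L by (rule subring_L)
  show "complex_subring OL"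
    using algebraic_ints.diff_mem algebraic_ints.mult_mem
    by unfold_locales (auto simp: ring_of_integers_def L.one_mem L.diff_mem L.mult_mem)
qed

lemma O_Qbar: "x \<in> OL \<Longrightarrow> x \<in> Qbar"
  using L_subset by (auto simp: ring_of_integers_def)

lemma cnj_O: "x \<in> OL \<Longrightarrow> cnj x \<in> OL"
  by (auto simp: ring_of_integers_def cnj_L)

lemma O_small: "x \<in> OL \<Longrightarrow> (\<And>\<sigma>. embedding \<sigma> \<Longrightarrow> norm (\<sigma> x) < 1) \<Longrightarrow> x = 0"
  by (intro algebraic_int_small_eq_0) (auto simp: ring_of_integers_def)

lemma unit_cong_1_real:
  assumes OL: "u \<in> OL" "w \<in> OL" "y \<in> OL" and uw: "u * w = 1" and u: "u = 1 + 3 * y"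
    and \<sigma>: "embedding \<sigma>"
  shows "\<sigma> u \<in> \<real>"
proof -
  \<comment> \<open>As \<open>w\<close> is the inverse of \<open>u\<close>, this is (cnj u / u - 1)
    / 3; writing it with \<open>y\<close> makes integrality visible. At each embedding cnj u / u has
    absolute value 1.\<close>
  define t where "t = (cnj y - y) * w"
  have t: "t \<in> OL" unfolding t_def using OL by (intro OL.mult_mem OL.diff_mem cnj_O)
  have t3: "3 * t = (cnj u - u) * w" by (simp add: t_def u algebra_simps)
  have "t = 0"
  proof (rule O_small[OF t])
    fix \<tau> assume \<tau>: "embedding \<tau>"
    have Q: "u \<in> Qbar" "w \<in> Qbar" "t \<in> Qbar" "cnj u \<in> Qbar" "3 \<in> Qbar"
      using OL t O_Qbar cnj_O Qbar.of_nat_mem[of 3] by auto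
    have "\<tau> (cnj u) = cnj (\<tau> u)" using OL(1) by (intro embedding_cnj \<tau>) (auto simp: ring_of_integers_def)
    then have "3 * \<tau> t = (cnj (\<tau> u) - \<tau> u) * \<tau> w"
      using arg_cong[OF t3, of \<tau>] \<tau> Q
      by (simp add: embedding_mult embedding_diff embedding_numeral Qbar.diff_mem)
    then have "norm (3 * \<tau> t) = norm (cnj (\<tau> u) - \<tau> u) * norm (\<tau> w)" by (simp add: norm_mult)
    also have "\<dots> \<le> (2 * norm (\<tau> u)) * norm (\<tau> w)"
      using norm_triangle_ineq4[of "cnj (\<tau> u)" "\<tau> u"] by (intro mult_right_mono) auto
    also have "\<dots> = 2 * norm (\<tau> (u * w))" using \<tau> Q by (simp add: embedding_mult norm_mult)
    also have "\<dots> = 2" using \<tau> by (simp add: uw embedding_1)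
    finally show "norm (\<tau> t) < 1" by (simp add: norm_mult)
  qed
  then have "cnj u = u" using t3 uw by auto
  then have "cnj (\<sigma> u) = \<sigma> u" using embedding_cnj[OF \<sigma>, of u] OL(1) by (simp add: ring_of_integers_def)
  then show ?thesis by (simp add: Reals_cnj_iff)
qed

text \<open>The form 36 x + 2 is the trace of the Pell unit that \<open>unit_trace_of_int\<close>
  attaches to an integer x.\<close>

definition unit_trace :: "complex \<Rightarrow> bool"
  where "unit_trace x \<longleftrightarrow> (\<exists>u\<in>OL. \<exists>w\<in>OL. \<exists>y\<in>OL. u * w = 1 \<and> u = 1 + 3 * y \<and> 36 * x + 2 = u + w)"

lemma unit_trace_real:
  assumes "unit_trace x" "x \<in> OL" "embedding \<sigma>" shows "\<sigma> x \<in> \<real>"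
proof -
  obtain u w y where OL: "u \<in> OL" "w \<in> OL" "y \<in> OL" and uw: "u * w = 1" and u: "u = 1 + 3 * y"
    and x: "36 * x + 2 = u + w" using assms(1) unit_trace_def by blast
  have Q: "u \<in> Qbar" "w \<in> Qbar" "x \<in> Qbar" "2 \<in> Qbar" "36 \<in> Qbar"
    using OL assms(2) O_Qbar Qbar.of_nat_mem[of 2] Qbar.of_nat_mem[of 36] by auto
  have "\<sigma> u \<in> \<real>" using unit_cong_1_real[OF OL uw u assms(3)] .
  moreover have "\<sigma> u * \<sigma> w = 1" using arg_cong[OF uw, of \<sigma>] assms(3) Q
    by (simp add: embedding_mult embedding_1)
  then have "\<sigma> w = inverse (\<sigma> u)" by (metis inverse_unique)
  moreover have "36 * \<sigma> x + 2 = \<sigma> u + \<sigma> w"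
    using arg_cong[OF x, of \<sigma>] assms(3) Q
    by (simp add: embedding_mult embedding_add embedding_numeral Qbar.mult_mem)
  then have "\<sigma> x = (\<sigma> u + \<sigma> w - 2) / 36" by (simp add: field_simps)
  ultimately show ?thesis by (simp only:) (intro Reals_divide Reals_diff Reals_add Reals_inverse Reals_numeral)
qed

text \<open>The Pell identity (1 + 18 e)^2 - 36 e (9 e + 1) = 1 makes 1 + 18 e + 6 s and 1 + 18 e -
  6 s mutually inverse; their sum is 36 e + 2, and \<open>y\<close> is 6 e + 2 s.\<close>

lemma unit_trace_of_int: "unit_trace (of_int e)"
proof -
  define m where "m = nat (e * (9 * e + 1))"
  define s where "s = complex_of_real (sqrt (of_nat m))"
  \<comment> \<open>For an integer \<open>e\<close> the two factors never have opposite signs, so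
    \<open>nat\<close> loses nothing.\<close>
  have "e * (9 * e + 1) \<ge> 0" by (cases "e \<ge> 0") (auto simp: mult_nonpos_nonpos)
  then have "int m = e * (9 * e + 1)" by (simp add: m_def)
  then have "complex_of_int (int m) = of_int (e * (9 * e + 1))" by simp
  moreover have "s ^ 2 = of_nat m"
    unfolding s_def by (simp flip: of_real_power)
  ultimately have s2: "s * s = of_int e * (9 * of_int e + 1)" by (simp add: power2_eq_square)
  have "s \<in> OL" using sqrt_L by (auto simp: ring_of_integers_def s_def)
  moreover have "of_int e \<in> OL" "1 \<in> OL" "6 \<in> OL" "18 \<in> OL" "2 \<in> OL" "3 \<in> OL"
    using OL.of_nat_mem[of 6] OL.of_nat_mem[of 18] OL.of_nat_mem[of 2] OL.of_nat_mem[of 3]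
    by (auto simp: OL.of_int_mem OL.one_mem)
  moreover have "(1 + 18 * of_int e + 6 * s) * (1 + 18 * of_int e - 6 * s) = 1"
  proof -
    have "(1 + 18 * of_int e + 6 * s) * (1 + 18 * of_int e - 6 * s) =
        1 + 36 * (of_int e * (9 * of_int e + 1) - s * s)"
      by (simp add: algebra_simps)
    then show ?thesis by (simp add: s2)
  qed
  ultimately show ?thesis
    unfolding unit_trace_def
    by (intro bexI[of _ "1 + 18 * of_int e + 6 * s"] bexI[of _ "1 + 18 * of_int e - 6 * s"]
        bexI[of _ "6 * of_int e + 2 * s"]) (auto intro!: OL.add_mem OL.mult_mem OL.diff_mem)
qed

section \<open>Coding of finite segments of the integers by three ring elements\<close>

text \<open>The parameters code a finite set of integers, so that quantifying over such sets becomes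
  quantifying over elements of the ring.\<close>

definition segment :: "complex \<Rightarrow> complex \<Rightarrow> complex \<Rightarrow> complex \<Rightarrow> bool"
  where "segment f g h x \<longleftrightarrow> unit_trace x \<and> (\<exists>z\<in>OL. f = (1 + x * x) * z) \<and> (\<exists>z\<in>OL. h = (1 + g * (x * x)) * z)"

text \<open>If \<open>n\<close> were not a natural number, induction would put every natural k into
  the segment, so 1 + k^2 would divide the nonzero \<open>f\<close> for every k.\<close>

lemma segment_sound:
  assumes f: "f \<in> OL" "f \<noteq> 0" and "segment f g h 0"
    and step: "\<And>x. x \<in> OL \<Longrightarrow> segment f g h x \<Longrightarrow> x = n \<or> segment f g h (x + 1)"
  shows "n \<in> \<nat>"
proof (rule ccontr)
  assume n: "n \<notin> \<nat>"
  have seg: "segment f g h (of_nat k)" for k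
  proof (induction k)
    case (Suc k)
    have "of_nat k \<noteq> n" using n by auto
    then have "segment f g h (of_nat k + 1)" using step[OF OL.of_nat_mem Suc] by blast
    then show ?case by (simp add: add.commute)
  qed (use assms(3) in simp)
  obtain B where B: "\<And>\<sigma>. embedding \<sigma> \<Longrightarrow> norm (\<sigma> f) \<le> B"
    using bounded_embeddings[OF O_Qbar[OF f(1)]] by blast
  \<comment> \<open>For such \<open>k\<close> every conjugate of the quotient \<open>z\<close> is
    below 1 in absolute value.\<close>
  obtain k :: nat where k: "B < of_nat k" using reals_Archimedean2 by blast
  obtain z where z: "z \<in> OL" "f = of_nat (1 + k * k) * z"
    using seg[of k] unfolding segment_def by (auto simp: of_nat_add of_nat_mult)
  have "z = 0"
  proof (rule O_small[OF z(1)])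
    fix \<sigma> assume \<sigma>: "embedding \<sigma>"
    have "\<sigma> f = of_nat (1 + k * k) * \<sigma> z"
      using \<sigma> O_Qbar[OF z(1)] unfolding z(2)
      by (simp only: embedding_mult[OF \<sigma> Qbar.of_nat_mem] embedding_of_nat[OF \<sigma>])
    then have "norm (\<sigma> f) = of_nat (1 + k * k) * norm (\<sigma> z)" by (simp only: norm_mult norm_of_nat)
    moreover have "norm (\<sigma> f) < of_nat (1 + k * k)"
    proof -
      have "real k \<le> real (1 + k * k)" by (simp only: of_nat_le_iff) (cases k; simp)
      then show ?thesis using B[OF \<sigma>] k by linarith
    qed
    ultimately have "of_nat (1 + k * k) * norm (\<sigma> z) < of_nat (1 + k * k) * 1" by (simp only: mult_1_right)
    then show "norm (\<sigma> z) < 1" by (subst (asm) mult_less_cancel_left_pos) (auto simp del: of_nat_Suc)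
  qed
  then show False using f(2) z(2) by simp
qed

text \<open>The element \<open>q\<close> divides the product of all i^2 - x^2 by
  \<open>prod_square_diff_mod\<close>. Unless x = 0, the quotient must vanish, because a suitable
  nonzero multiple of it has only small conjugates.\<close>

lemma segment_bound:
  fixes n G :: nat
  defines "F \<equiv> (\<Prod>i\<le>n. 1 + i * i)"
  assumes G: "(Suc n ^ 2 * F) ^ Suc n < G" and x: "x \<in> OL"
    and seg: "segment (of_nat F) (of_nat G) (of_nat (\<Prod>i\<le>n. 1 + G * (i * i))) x"
  shows "\<exists>i\<le>n. x = of_nat i \<or> x = - of_nat i"
proof -
  have unit_trace: "unit_trace x" and ex_y: "\<exists>y\<in>OL. of_nat F = (1 + x * x) * y"
    and ex_z: "\<exists>z\<in>OL. of_nat (\<Prod>i\<le>n. 1 + G * (i * i)) = (1 + of_nat G * (x * x)) * z"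
    using seg unfolding segment_def by - (elim conjE, assumption)+
  from ex_y obtain y where y: "y \<in> OL" "of_nat F = (1 + x * x) * y" by (rule bexE)
  from ex_z obtain z where z: "z \<in> OL"
    "of_nat (\<Prod>i\<le>n. 1 + G * (i * i)) = (1 + of_nat G * (x * x)) * z" by (rule bexE)
  define q where "q = 1 + of_nat G * x ^ 2"
  obtain c where c: "c \<in> OL" "(\<Prod>i\<le>n. of_nat i ^ 2 - x ^ 2) =
      q * c + (- (x ^ 2)) ^ Suc n * (\<Prod>i\<le>n. 1 + of_nat G * of_nat i ^ 2)"
    unfolding q_def using OL.prod_square_diff_mod[OF x OL.of_nat_mem[of G], of n] by (rule bexE)
  have "(\<Prod>i\<le>n. 1 + of_nat G * of_nat i ^ 2) = q * z"
    using z(2) by (simp add: q_def power2_eq_square)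
  then have prod: "(\<Prod>i\<le>n. of_nat i ^ 2 - x ^ 2) = q * (c + (- (x ^ 2)) ^ Suc n * z)"
    using c(2) by (simp add: algebra_simps)
  define w where "w = c + (- (x ^ 2)) ^ Suc n * z"
  have w: "w \<in> OL" unfolding w_def using c z x by (intro OL.add_mem OL.mult_mem OL.power_mem OL.minus_mem)
  \<comment> \<open>Each of the n + 1 factors of the product grows like 1 + x^2, which a factor y =
    F / (1 + x^2) offsets; x^2 offsets the failure of \<open>q\<close> to be large where x is
    small.\<close>
  define t where "t = w * y ^ Suc n * x ^ 2"
  have t: "t \<in> OL" unfolding t_def using w y x by (intro OL.mult_mem OL.power_mem)
  have "t = 0"
  proof (rule O_small[OF t])
    fix \<sigma> assume \<sigma>: "embedding \<sigma>"
    \<comment> \<open>Reality of the conjugates makes 1 + r^2 and 1 + G r^2 at least 1, so the norms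
      below are exact.\<close>
    obtain r where r: "\<sigma> x = complex_of_real r"
      using unit_trace_real[OF unit_trace x \<sigma>] by (rule Reals_cases)
    have Q: "x \<in> Qbar" "y \<in> Qbar" "w \<in> Qbar" "q \<in> Qbar"
      using x y w O_Qbar
      by (auto simp: q_def intro!: Qbar.add_mem Qbar.one_mem Qbar.mult_mem Qbar.of_nat_mem
          Qbar.power_mem)
    have \<sigma>q: "\<sigma> q = of_real (1 + real G * r ^ 2)"
      unfolding q_def using \<sigma> Q
      by (simp add: embedding_add embedding_1 embedding_mult embedding_of_nat embedding_power r
          Qbar.one_mem Qbar.mult_mem Qbar.of_nat_mem Qbar.power_mem)
    have "\<sigma> (of_nat F) = (1 + \<sigma> x * \<sigma> x) * \<sigma> y"
      unfolding y(2) using \<sigma> Q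
      by (simp add: embedding_add embedding_1 embedding_mult Qbar.one_mem Qbar.mult_mem Qbar.add_mem)
    then have "of_nat F = of_real (1 + r ^ 2) * \<sigma> y"
      using \<sigma> by (simp add: embedding_of_nat r power2_eq_square)
    then have "norm (of_nat F :: complex) = norm (complex_of_real (1 + r ^ 2)) * norm (\<sigma> y)"
      by (simp only: norm_mult)
    then have Fy: "real F = (1 + r ^ 2) * norm (\<sigma> y)"
      by (simp only: norm_of_nat norm_of_real) (simp add: add_nonneg_nonneg)
    have "\<sigma> (\<Prod>i\<le>n. of_nat i ^ 2 - x ^ 2) = (\<Prod>i\<le>n. complex_of_real (real i ^ 2 - r ^ 2))"
      using \<sigma> Q by (simp add: embedding_prod embedding_diff embedding_power embedding_of_nat r
          Qbar.diff_mem Qbar.of_nat_mem Qbar.power_mem)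
    then have "(\<Prod>i\<le>n. complex_of_real (real i ^ 2 - r ^ 2)) = of_real (1 + real G * r ^ 2) * \<sigma> w"
      using prod \<sigma> Q by (simp only: w_def[symmetric] embedding_mult[OF \<sigma>] \<sigma>q)
    then have "norm (\<Prod>i\<le>n. complex_of_real (real i ^ 2 - r ^ 2)) =
        norm (complex_of_real (1 + real G * r ^ 2)) * norm (\<sigma> w)"
      by (simp only: norm_mult)
    then have wG: "(\<Prod>i\<le>n. \<bar>real i ^ 2 - r ^ 2\<bar>) = (1 + real G * r ^ 2) * norm (\<sigma> w)"
      by (simp only: prod_norm[symmetric] norm_of_real) (simp add: add_nonneg_nonneg)
    have "(\<Prod>i\<le>n. \<bar>real i ^ 2 - r ^ 2\<bar>) \<le> (\<Prod>i\<le>n. real (Suc n) ^ 2 * (1 + r ^ 2))"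
    proof (intro prod_mono conjI)
      fix i assume "i \<in> {..n}"
      then have "real i ^ 2 \<le> real (Suc n) ^ 2" by (intro power_mono) auto
      moreover have "r ^ 2 \<le> real (Suc n) ^ 2 * r ^ 2"
        using mult_right_mono[of 1 "real (Suc n) ^ 2" "r ^ 2"] one_le_power[of "real (Suc n)" 2] by simp
      moreover have "\<bar>real i ^ 2 - r ^ 2\<bar> \<le> real i ^ 2 + r ^ 2"
        by (simp add: abs_le_iff)
      ultimately show "\<bar>real i ^ 2 - r ^ 2\<bar> \<le> real (Suc n) ^ 2 * (1 + r ^ 2)"
        unfolding distrib_left mult_1_right by linarith
    qed auto
    also have "\<dots> = (real (Suc n) ^ 2 * (1 + r ^ 2)) ^ Suc n" by simp
    finally have wle: "(1 + real G * r ^ 2) * norm (\<sigma> w) \<le> (real (Suc n) ^ 2 * (1 + r ^ 2)) ^ Suc n"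
      using wG by simp
    have "\<sigma> t = \<sigma> w * \<sigma> y ^ Suc n * \<sigma> x ^ 2"
      unfolding t_def using \<sigma> Q
      by (simp add: embedding_mult embedding_power Qbar.mult_mem Qbar.power_mem del: power_Suc)
    then have "norm (\<sigma> t) = norm (\<sigma> w) * norm (\<sigma> y) ^ Suc n * r ^ 2"
      by (simp add: norm_mult norm_power r del: power_Suc)
    then have "(1 + real G * r ^ 2) * norm (\<sigma> t) =
        ((1 + real G * r ^ 2) * norm (\<sigma> w)) * (norm (\<sigma> y) ^ Suc n * r ^ 2)"
      by (simp del: power_Suc)
    also have "\<dots> \<le> (real (Suc n) ^ 2 * (1 + r ^ 2)) ^ Suc n * (norm (\<sigma> y) ^ Suc n * r ^ 2)"
      using wle by (intro mult_right_mono) auto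
    also have "\<dots> = (real (Suc n) ^ 2 * real F) ^ Suc n * r ^ 2"
      by (simp add: Fy power_mult_distrib del: power_Suc of_nat_Suc)
    also have "\<dots> = real ((Suc n ^ 2 * F) ^ Suc n) * r ^ 2" by (simp del: power_Suc of_nat_Suc)
    \<comment> \<open>This is where \<open>G\<close> has to be large; the bound then stays below the
      conjugate 1 + G r^2 of \<open>q\<close>, even for r = 0.\<close>
    also have "\<dots> \<le> real G * r ^ 2" using G by (intro mult_right_mono) (simp_all del: power_Suc of_nat_power)
    also have "\<dots> < 1 + real G * r ^ 2" by simp
    finally have "(1 + real G * r ^ 2) * norm (\<sigma> t) < (1 + real G * r ^ 2) * 1" by simp
    moreover have "1 + real G * r ^ 2 > 0" by (simp add: add_pos_nonneg)
    ultimately show "norm (\<sigma> t) < 1" by (simp only: mult_less_cancel_left_pos)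
  qed
  moreover have "y \<noteq> 0"
  proof -
    have "F \<noteq> 0" by (simp add: F_def)
    then show ?thesis using y(2) by auto
  qed
  ultimately have "x = 0 \<or> w = 0" by (auto simp: t_def)
  then have "(\<Prod>i\<le>n. of_nat i ^ 2 - x ^ 2) = 0"
  proof
    assume "x = 0"
    then show ?thesis by (intro prod_zero bexI[of _ 0]) auto
  qed (simp only: prod w_def[symmetric] mult_zero_right)
  then obtain i where "i \<le> n" "(of_nat i :: complex) ^ 2 = x ^ 2" by auto
  then show ?thesis by (auto simp: power2_eq_iff)
qed

text \<open>With these parameters the segment consists of the integers from -n to n, and only n has
  its successor outside.\<close>

lemma segment_complete:
  fixes n :: nat
  shows "\<exists>f\<in>OL. \<exists>g\<in>OL. \<exists>h\<in>OL. f \<noteq> 0 \<and> segment f g h 0 \<and>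
    (\<forall>x\<in>OL. segment f g h x \<longrightarrow> x = of_nat n \<or> segment f g h (x + 1))"
proof -
  define F where "F = (\<Prod>i\<le>n. 1 + i * i)"
  \<comment> \<open>The least number meeting the strict bound of
    \<open>segment_bound\<close>.\<close>
  define G where "G = Suc ((Suc n ^ 2 * F) ^ Suc n)"
  define H where "H = (\<Prod>i\<le>n. 1 + G * (i * i))"
  let ?seg = "segment (of_nat F) (of_nat G) (of_nat H)"
  have mem: "?seg x" if "x = of_nat i \<or> x = - of_nat i" "i \<le> n" for x i
  proof -
    have "unit_trace x" using that(1) unit_trace_of_int[of "int i"] unit_trace_of_int[of "- int i"] by auto
    moreover have xx: "x * x = of_nat (i * i)" using that(1) by auto
    moreover have "F = (1 + i * i) * (\<Prod>j\<in>{..n} - {i}. 1 + j * j)"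
      unfolding F_def using that(2) by (intro prod.remove) auto
    then have "of_nat F = (1 + x * x) * of_nat (\<Prod>j\<in>{..n} - {i}. 1 + j * j)"
      unfolding xx by (simp only: of_nat_mult of_nat_add of_nat_1)
    moreover have "H = (1 + G * (i * i)) * (\<Prod>j\<in>{..n} - {i}. 1 + G * (j * j))"
      unfolding H_def using that(2) by (intro prod.remove) auto
    then have "of_nat H = (1 + of_nat G * (x * x)) * of_nat (\<Prod>j\<in>{..n} - {i}. 1 + G * (j * j))"
      unfolding xx by (simp only: of_nat_mult of_nat_add of_nat_1)
    ultimately show ?thesis unfolding segment_def using OL.of_nat_mem by blast
  qed
  have "x = of_nat n \<or> ?seg (x + 1)" if x: "x \<in> OL" "?seg x" for x
  proof -
    obtain i where i: "i \<le> n" "x = of_nat i \<or> x = - of_nat i"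
      using segment_bound[of n G x] x by (auto simp: F_def G_def H_def)
    show ?thesis
    proof (cases "x = of_nat i")
      case True
      show ?thesis
      proof (cases "i = n")
        case False
        then show ?thesis using True i mem[of "x + 1" "Suc i"] by (simp add: add.commute)
      qed (use True in simp)
    next
      case False
      \<comment> \<open>Here i is positive, since otherwise x would equal \<open>of_nat i\<close>;
        hence the truncated difference is the true one.\<close>
      then have "x + 1 = - of_nat (i - 1)" using i by (cases i) auto
      then show ?thesis using i mem[of "x + 1" "i - 1"] by simp
    qed
  qed
  moreover have "?seg 0" using mem[of 0 0] by simp
  moreover have "F \<noteq> 0" by (simp add: F_def)
  then have "(of_nat F :: complex) \<noteq> 0" by (simp only: of_nat_eq_0_iff not_False_eq_True)
  ultimately show ?thesis using OL.of_nat_mem by blast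
qed

end

text \<open>
  In the formula for the variable \<open>i\<close>, the variables \<open>i + 1\<close>, \<open>i + 2\<close>, \<open>i + 3\<close> hold the parameters
  \<open>f\<close>, \<open>g\<close>, \<open>h\<close> of a segment, and \<open>i + 4\<close> and \<open>i + 9\<close> its elements.
\<close>

definition unit_trace_form :: "nat \<Rightarrow> nat \<Rightarrow> rform"
  where "unit_trace_form i j = FEx (i + 5) (FEx (i + 6) (FEx (i + 7)
    (FAnd (FEq (Mul (Var (i + 5)) (Var (i + 6))) One)
      (FAnd (FEq (Var (i + 5)) (Add One (Mul (numeral_term 3) (Var (i + 7)))))
        (FEq (Add (Mul (numeral_term 36) (Var j)) (numeral_term 2))
          (Add (Var (i + 5)) (Var (i + 6))))))))"

definition segment_form :: "nat \<Rightarrow> nat \<Rightarrow> rform"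
  where "segment_form i j = FAnd (unit_trace_form i j)
    (FAnd (FEx (i + 8) (FEq (Var (i + 1)) (Mul (Add One (Mul (Var j) (Var j))) (Var (i + 8)))))
      (FEx (i + 8) (FEq (Var (i + 3))
        (Mul (Add One (Mul (Var (i + 2)) (Mul (Var j) (Var j)))) (Var (i + 8))))))"

text \<open>Substituting 0 and x + 1 into the segment formula is done by quantifying a variable that
  is equated with the term.\<close>

definition nat_form :: "nat \<Rightarrow> rform"
  where "nat_form i = FEx (i + 1) (FEx (i + 2) (FEx (i + 3)
    (FAnd (FNot (FEq (Var (i + 1)) Zero))
      (FAnd (FEx (i + 4) (FAnd (FEq (Var (i + 4)) Zero) (segment_form i (i + 4))))
        (FNot (FEx (i + 4) (FAnd (segment_form i (i + 4)) (FAnd (FNot (FEq (Var (i + 4)) (Var i)))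
          (FNot (FEx (i + 9) (FAnd (FEq (Var (i + 9)) (Add (Var (i + 4)) One))
            (segment_form i (i + 9)))))))))))))"

context cm_field begin

text \<open>Variables i + 5 to i + 7 hold the unit, its inverse and the congruence witness, and i +
  8 a quotient; \<open>j\<close> must avoid these bound variables.\<close>

lemma sat_segment_form:
  assumes "j \<notin> {i + 5..i + 8}"
  shows "sat OL e (segment_form i j) \<longleftrightarrow> segment (e (i + 1)) (e (i + 2)) (e (i + 3)) (e j)"
proof -
  have "j \<noteq> i + 5" "j \<noteq> i + 6" "j \<noteq> i + 7" "j \<noteq> i + 8" using assms by auto
  then show ?thesis by (simp add: segment_form_def unit_trace_form_def segment_def unit_trace_def)
qed

lemma sat_nat_form:
  assumes "e i \<in> OL"
  shows "sat OL e (nat_form i) \<longleftrightarrow> e i \<in> \<nat>"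
proof -
  have "sat OL e (nat_form i) \<longleftrightarrow> (\<exists>f\<in>OL. \<exists>g\<in>OL. \<exists>h\<in>OL. f \<noteq> 0 \<and> segment f g h 0 \<and>
      (\<forall>x\<in>OL. segment f g h x \<longrightarrow> x = e i \<or> segment f g h (x + 1)))"
    using OL.zero_mem OL.one_mem OL.add_mem by (auto simp: nat_form_def sat_segment_form)
  also have "\<dots> \<longleftrightarrow> e i \<in> \<nat>"
    using segment_sound segment_complete by (auto elim!: Nats_cases)
  finally show ?thesis .
qed

lemma not_decidable: "\<not> decidable (first_order_theory OL)"
proof -
  interpret definable_nats OL nat_form
    by unfold_locales (auto simp: OL.of_nat_mem sat_nat_form)
  show ?thesis by (rule not_decidable_theory)
qed

end

section \<open>The totally imaginary quadratic extension\<close>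

lemma CC_simps [simp]:
  "carrier CC = UNIV" "x \<otimes>\<^bsub>CC\<^esub> y = x * y" "x \<oplus>\<^bsub>CC\<^esub> y = x + y" "\<one>\<^bsub>CC\<^esub> = 1" "\<zero>\<^bsub>CC\<^esub> = 0"
  by (auto simp: ring_of_type_algebra_def)

lemma field_CC: "field CC"
  by (rule field_from_type_algebra)

interpretation CC: ring CC
  by (rule ring_from_type_algebra)

lemma CC_a_inv [simp]: "\<ominus>\<^bsub>CC\<^esub> x = - x"
  by (rule CC.minus_equality) auto

lemma CC_inv [simp]: "x \<noteq> 0 \<Longrightarrow> inv\<^bsub>CC\<^esub> x = inverse x"
  by (rule CC.inv_unique'[symmetric]) auto

text \<open>Because \<open>inverse 0 = 0\<close>, closure under inverses can be stated for all
  elements.\<close>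

lemma subfield_CC_iff:
  "subfield F CC \<longleftrightarrow> complex_subring F \<and> (\<forall>x\<in>F. inverse x \<in> F)"
proof
  assume F: "subfield F CC"
  note sub = subringE[OF subfieldE(1)[OF F], simplified]
  have "x - y \<in> F" if "x \<in> F" "y \<in> F" for x y
    using sub(7)[of x "- y"] sub(5)[of y] that by simp
  then have "complex_subring F" using sub by unfold_locales auto
  moreover have "inverse x \<in> F" if "x \<in> F" for x
    using CC.subfield_m_inv(1)[OF F, of x] that by (cases "x = 0") auto
  ultimately show "complex_subring F \<and> (\<forall>x\<in>F. inverse x \<in> F)" by blast
next
  assume F: "complex_subring F \<and> (\<forall>x\<in>F. inverse x \<in> F)"
  then interpret complex_subring F by blast
  have "subring F CC"
    by (rule CC.subringI) (auto simp: one_mem minus_mem add_mem mult_mem)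
  then show "subfield F CC"
    using F by (intro field.subfieldI'[OF field_CC]) auto
qed

lemma subfield_generate_field: "subfield (generate_field CC S) CC"
  by (rule field.generate_field_is_subfield[OF field_CC]) simp

lemma totally_real_field_Qbar: "totally_real_field F \<Longrightarrow> x \<in> F \<Longrightarrow> x \<in> Qbar"
  by (auto simp: totally_real_field_def totally_real_def Qbar_def)

lemma totally_real_field_generate:
  assumes "\<And>x. x \<in> S \<Longrightarrow> totally_real x"
  shows "totally_real_field (generate_field CC S)"
proof -
  have "totally_real x" if "x \<in> generate_field CC S" for x
    using that
  proof (induction rule: generate_field.induct)
    case (incl h)
    then show ?case by (rule assms)
  next
    case (m_inv h)
    then show ?case
      by (auto simp: totally_real_iff_embedding embedding_inverse Qbar_inverse)
  qed (auto simp: assms totally_real_iff_embedding embedding_1 embedding_minus embedding_add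
      embedding_mult Qbar.one_mem Qbar.minus_mem Qbar.add_mem Qbar.mult_mem)
  then show ?thesis by (simp add: totally_real_field_def subfield_generate_field)
qed

section \<open>Square roots of natural numbers\<close>

lemma sqrt_Qbar: "complex_of_real (sqrt (of_nat m)) \<in> Qbar"
  by (auto simp: Qbar_def)

lemma sqrt_totally_real: "totally_real (complex_of_real (sqrt (of_nat m)))"
proof -
  let ?s = "complex_of_real (sqrt (of_nat m))"
  have s2: "?s ^ 2 = of_nat m" by (simp flip: of_real_power)
  have "\<sigma> ?s \<in> \<real>" if "embedding \<sigma>" for \<sigma>
  proof -
    have "\<sigma> ?s ^ 2 = ?s ^ 2"
      using embedding_power[OF that sqrt_Qbar, of m 2] embedding_of_nat[OF that, of m] s2 by simp
    then have "\<sigma> ?s = ?s \<or> \<sigma> ?s = - ?s" by (simp add: power2_eq_iff)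
    then show ?thesis by auto
  qed
  then show ?thesis by (simp add: totally_real_iff_embedding sqrt_Qbar)
qed

text \<open>Either the root lies in \<open>K\<close>, an extension of degree 1 of itself, or K s + K
  is a quadratic extension.\<close>

lemma sqrt_in_compositum2:
  assumes K: "totally_real_field K"
  shows "complex_of_real (sqrt (of_nat m)) \<in> compositum2 K"
proof -
  let ?s = "complex_of_real (sqrt (of_nat m))"
  have sf: "subfield K CC" using K by (simp add: totally_real_field_def)
  then interpret K: complex_subring K by (simp add: subfield_CC_iff)
  have inv: "inverse x \<in> K" if "x \<in> K" for x using sf that by (simp add: subfield_CC_iff)
  have s2: "?s * ?s = of_nat m" by (simp flip: of_real_mult)
  have dim0: "ring.dimension CC 0 K {0}" using CC.zero_dim[of K] by simp
  have dim1: "ring.dimension CC 1 K (ring.line_extension CC K 1 {0})"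
    using CC.Suc_dim[of 1 "{0}" 0 K] dim0 by simp
  have line1: "ring.line_extension CC K 1 {0} = K"
    using CC.line_extension_mem_iff[of _ K 1 "{0}"] by auto
  define E where "E = ring.line_extension CC K ?s K"
  have E_iff: "x \<in> E \<longleftrightarrow> (\<exists>a\<in>K. \<exists>b\<in>K. x = a * ?s + b)" for x
    by (simp add: E_def CC.line_extension_mem_iff)
  have "\<exists>n\<le>2. \<exists>E. E \<subseteq> Qbar \<and> extension_of_degree n K E \<and> ?s \<in> E"
  proof (cases "?s \<in> K")
    case True
    then show ?thesis
      using sf dim1 totally_real_field_Qbar[OF K]
      by (intro exI[of _ 1] conjI exI[of _ K]) (auto simp: extension_of_degree_def line1)
  next
    case False
    have "ring.dimension CC (Suc 1) K E"
      unfolding E_def using dim1 False by (intro CC.Suc_dim) (auto simp: line1)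
    moreover have "K \<subseteq> E" unfolding subset_iff E_iff by (metis K.zero_mem add_0 mult_zero_left)
    moreover have "?s \<in> E" unfolding E_iff by (metis K.zero_mem K.one_mem add.right_neutral mult_1)
    moreover have "E \<subseteq> Qbar"
      using totally_real_field_Qbar[OF K] sqrt_Qbar
      by (auto simp: E_iff intro!: Qbar.add_mem Qbar.mult_mem)
    moreover have "subfield E CC"
      unfolding subfield_CC_iff
    proof
      show "complex_subring E"
      proof
        show "1 \<in> E" using \<open>K \<subseteq> E\<close> K.one_mem by blast
      next
        fix x y assume "x \<in> E" "y \<in> E"
        then obtain a b c d where abcd: "a \<in> K" "b \<in> K" "c \<in> K" "d \<in> K"
          "x = a * ?s + b" "y = c * ?s + d" unfolding E_iff by blast
        have "x - y = (a - c) * ?s + (b - d)" by (simp add: abcd algebra_simps)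
        then show "x - y \<in> E" unfolding E_iff using abcd K.diff_mem by blast
        have "x * y = (a * d + b * c) * ?s + (a * c * (?s * ?s) + b * d)"
          by (simp add: abcd algebra_simps)
        then have "x * y = (a * d + b * c) * ?s + (a * c * of_nat m + b * d)" by (simp only: s2)
        moreover have "a * d + b * c \<in> K" "a * c * of_nat m + b * d \<in> K"
          using abcd by (auto intro!: K.add_mem K.mult_mem K.of_nat_mem)
        ultimately show "x * y \<in> E" unfolding E_iff by blast
      qed
    next
      show "\<forall>x\<in>E. inverse x \<in> E"
      proof
        fix x assume "x \<in> E"
        then obtain a b where ab: "a \<in> K" "b \<in> K" "x = a * ?s + b" unfolding E_iff by blast
        \<comment> \<open>The relative norm of \<open>x\<close>; inverses are found by multiplying
          with the conjugate b - a s, which is nonzero because s is not in \<open>K\<close>.\<close>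
        define N where "N = b * b - a * a * of_nat m"
        have N: "N \<in> K" using ab by (auto simp: N_def intro!: K.diff_mem K.mult_mem K.of_nat_mem)
        have "x * (b - a * ?s) = b * b - a * a * (?s * ?s)" by (simp add: ab algebra_simps)
        then have xN: "x * (b - a * ?s) = N" by (simp only: N_def s2)
        show "inverse x \<in> E"
        proof (cases "x = 0")
          case True
          then show ?thesis using \<open>x \<in> E\<close> by simp
        next
          case nz: False
          have "b - a * ?s \<noteq> 0"
          proof
            assume eq: "b - a * ?s = 0"
            then have "a \<noteq> 0" using nz ab by auto
            then have "?s = b * inverse a" using eq by (simp add: field_simps)
            then show False using False ab inv K.mult_mem by auto
          qed
          then have "N \<noteq> 0" using xN nz by auto
          then have "inverse x = (- a * inverse N) * ?s + b * inverse N"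
            using xN nz by (simp add: field_simps)
          moreover have "- a * inverse N \<in> K" "b * inverse N \<in> K"
            using ab N inv by (auto intro!: K.mult_mem K.minus_mem)
          ultimately show ?thesis unfolding E_iff by blast
        qed
      qed
    qed
    ultimately show ?thesis
      using sf by (intro exI[of _ 2] conjI exI[of _ E]) (auto simp: extension_of_degree_def numeral_2_eq_2)
  qed
  then show ?thesis unfolding compositum2_def by (intro generate_field.incl) blast
qed

text \<open>Adjoining the root to \<open>E\<close> stays totally real and inside the compositum, so
  maximality says that nothing was added.\<close>

lemma sqrt_in_maximal_totally_real_subfield:
  assumes K: "totally_real_field K" and max: "maximal_totally_real_subfield E (compositum2 K)"
  shows "complex_of_real (sqrt (of_nat m)) \<in> E"
proof -
  let ?s = "complex_of_real (sqrt (of_nat m))"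
  let ?E = "generate_field CC (insert ?s E)"
  have E: "totally_real_field E" "E \<subseteq> compositum2 K"
    using max by (auto simp: maximal_totally_real_subfield_def)
  have "?E \<subseteq> compositum2 K"
  proof (rule field.generate_field_min_subfield1[OF field_CC])
    show "subfield (compositum2 K) CC" unfolding compositum2_def by (rule subfield_generate_field)
    show "insert ?s E \<subseteq> compositum2 K" using E(2) sqrt_in_compositum2[OF K] by simp
  qed simp
  moreover have "totally_real_field ?E"
    using E(1) sqrt_totally_real
    by (intro totally_real_field_generate) (auto simp: totally_real_field_def)
  moreover have "insert ?s E \<subseteq> ?E" by (auto intro: generate_field.incl)
  ultimately show ?thesis using max unfolding maximal_totally_real_subfield_def by blast
qed

section \<open>Complex conjugation on the totally imaginary quadratic extension\<close>

lemma quadratic_extension_generator: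
  assumes "extension_of_degree 2 K L"
  shows "\<exists>\<delta>\<in>L. \<delta> ^ 2 \<in> K \<and> (\<forall>x\<in>L. \<exists>a\<in>K. \<exists>b\<in>K. x = a + b * \<delta>)"
proof -
  have sf: "subfield K CC" "subfield L CC" and "K \<subseteq> L" and dim: "ring.dimension CC 2 K L"
    using assms by (auto simp: extension_of_degree_def)
  interpret K: complex_subring K using sf by (simp add: subfield_CC_iff)
  interpret L: complex_subring L using sf by (simp add: subfield_CC_iff)
  have inv: "inverse x \<in> K" if "x \<in> K" for x using sf that by (simp add: subfield_CC_iff)
  have dim_Suc: "\<exists>v E'. E = ring.line_extension CC K v E' \<and> ring.dimension CC n K E'"
    if "ring.dimension CC (Suc n) K E" for n E
    using that by cases blast+
  have dim_0: "E = {0}" if "ring.dimension CC 0 K E" for E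
    using that by cases auto
  obtain v w where vw: "L = ring.line_extension CC K v (ring.line_extension CC K w {0})"
    using dim dim_Suc dim_0 unfolding numeral_2_eq_2 by metis
  have L_iff: "x \<in> L \<longleftrightarrow> (\<exists>a\<in>K. \<exists>b\<in>K. x = a * v + b * w)" for x
    by (fastforce simp: vw CC.line_extension_mem_iff)
  have vL: "v \<in> L" "w \<in> L"
    unfolding L_iff using K.zero_mem K.one_mem by force+
  \<comment> \<open>A relation for 1 allows one of the two basis vectors to be exchanged for 1;
    which one depends on whether q vanishes.\<close>
  obtain p q where pq: "p \<in> K" "q \<in> K" "1 = p * v + q * w" using L.one_mem L_iff by blast
  have "\<exists>\<theta>\<in>L. \<forall>x\<in>L. \<exists>a\<in>K. \<exists>b\<in>K. x = a + b * \<theta>"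
  proof (cases "q = 0")
    case True
    then have v: "v = inverse p" using pq by (metis add.right_neutral inverse_unique mult_zero_left)
    have "\<exists>c\<in>K. \<exists>d\<in>K. x = c + d * w" if x: "x \<in> L" for x
    proof -
      obtain a b where "a \<in> K" "b \<in> K" "x = a * v + b * w" using x L_iff by blast
      then show ?thesis using v pq(1) inv K.mult_mem by blast
    qed
    then show ?thesis using vL by blast
  next
    case False
    then have w: "w = inverse q - p * inverse q * v" using pq by (simp add: field_simps)
    have "\<exists>c\<in>K. \<exists>d\<in>K. x = c + d * v" if x: "x \<in> L" for x
    proof -
      obtain a b where ab: "a \<in> K" "b \<in> K" "x = a * v + b * w" using x L_iff by blast
      have "x = b * inverse q + (a - b * (p * inverse q)) * v"
        by (simp add: ab w algebra_simps)
      moreover have "b * inverse q \<in> K" "a - b * (p * inverse q) \<in> K"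
        using ab pq inv by (auto intro!: K.mult_mem K.diff_mem)
      ultimately show ?thesis by blast
    qed
    then show ?thesis using vL by blast
  qed
  then obtain \<theta> where \<theta>: "\<theta> \<in> L" "\<And>x. x \<in> L \<Longrightarrow> \<exists>a\<in>K. \<exists>b\<in>K. x = a + b * \<theta>" by blast
  obtain a b where ab: "a \<in> K" "b \<in> K" "\<theta> * \<theta> = a + b * \<theta>" using \<theta>(2)[of "\<theta> * \<theta>"] \<theta>(1) L.mult_mem by blast
  \<comment> \<open>Completing the square: subtracting half of the linear coefficient leaves a
    generator whose square is in \<open>K\<close>.\<close>
  define h where "h = b * inverse 2"
  have h: "h \<in> K" unfolding h_def using ab inv[OF K.of_nat_mem[of 2]] by (intro K.mult_mem) auto
  define \<delta> where "\<delta> = \<theta> - h"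
  have "\<delta> ^ 2 = \<theta> * \<theta> - b * \<theta> + h * h" by (simp add: \<delta>_def h_def power2_eq_square algebra_simps)
  then have "\<delta> ^ 2 = a + h * h" by (simp add: ab)
  then have "\<delta> ^ 2 \<in> K" using ab h by (auto intro: K.add_mem K.mult_mem)
  moreover have "\<delta> \<in> L" unfolding \<delta>_def using \<theta>(1) h \<open>K \<subseteq> L\<close> by (auto intro: L.diff_mem)
  moreover have "\<exists>c\<in>K. \<exists>d\<in>K. x = c + d * \<delta>" if x: "x \<in> L" for x
  proof -
    obtain c d where cd: "c \<in> K" "d \<in> K" "x = c + d * \<theta>" using \<theta>(2)[OF x] by blast
    then have "x = (c + d * h) + d * \<delta>" by (simp add: \<delta>_def algebra_simps)
    then show ?thesis using cd h K.add_mem K.mult_mem by blast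
  qed
  ultimately show ?thesis by blast
qed

text \<open>Otherwise the real part of \<sigma> would be a ring homomorphism from \<open>L\<close>
  to the reals.\<close>

lemma totally_imaginary_embedding_not_real:
  assumes L: "totally_imaginary_field L" "L \<subseteq> Qbar" and \<sigma>: "embedding \<sigma>"
  shows "\<exists>x\<in>L. \<sigma> x \<notin> \<real>"
proof (rule ccontr)
  assume "\<not> (\<exists>x\<in>L. \<sigma> x \<notin> \<real>)"
  then have real: "\<And>x. x \<in> L \<Longrightarrow> \<sigma> x = of_real (Re (\<sigma> x))" by (auto simp: of_real_Re)
  have "(\<lambda>x. Re (\<sigma> x)) \<in> Ring.ring_hom (CC\<lparr>carrier := L\<rparr>) (ring_of_type_algebra :: real ring)"
  proof (rule ring_hom_memI)
    fix x y assume "x \<in> carrier (CC\<lparr>carrier := L\<rparr>)" "y \<in> carrier (CC\<lparr>carrier := L\<rparr>)"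
    then have xy: "x \<in> L" "y \<in> L" by auto
    then have Q: "x \<in> Qbar" "y \<in> Qbar" using L(2) by auto
    have "\<sigma> (x * y) = of_real (Re (\<sigma> x) * Re (\<sigma> y))"
      using embedding_mult[OF \<sigma> Q] real[OF xy(1)] real[OF xy(2)] by (metis of_real_mult)
    then show "Re (\<sigma> (x \<otimes>\<^bsub>CC\<lparr>carrier := L\<rparr>\<^esub> y)) = Re (\<sigma> x) \<otimes>\<^bsub>ring_of_type_algebra\<^esub> Re (\<sigma> y)"
      by (simp add: ring_of_type_algebra_def)
    show "Re (\<sigma> (x \<oplus>\<^bsub>CC\<lparr>carrier := L\<rparr>\<^esub> y)) = Re (\<sigma> x) \<oplus>\<^bsub>ring_of_type_algebra\<^esub> Re (\<sigma> y)"
      using embedding_add[OF \<sigma> Q] by (simp add: ring_of_type_algebra_def)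
  qed (auto simp: ring_of_type_algebra_def embedding_1[OF \<sigma>])
  then show False using L(1) by (simp add: totally_imaginary_field_def)
qed

lemma embedding_id: "embedding (\<lambda>x. x)"
  by (simp add: embedding_def)

text \<open>Every embedding makes \<open>K\<close> real and \<delta> purely imaginary, so
  conjugating the image of a + b \<delta> amounts to applying the same embedding to a - b
  \<delta>.\<close>

lemma cm_fieldI:
  assumes K: "totally_real_field K" and ext: "extension_of_degree 2 K L"
    and L: "totally_imaginary_field L" and sqrt: "\<And>m. complex_of_real (sqrt (of_nat m)) \<in> K"
  shows "cm_field L"
proof -
  obtain \<delta> where \<delta>: "\<delta> \<in> L" "\<delta> ^ 2 \<in> K" and gen: "\<And>x. x \<in> L \<Longrightarrow> \<exists>a\<in>K. \<exists>b\<in>K. x = a + b * \<delta>"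
    using quadratic_extension_generator[OF ext] by blast
  have sub: "complex_subring L" "K \<subseteq> L"
    using ext by (auto simp: extension_of_degree_def subfield_CC_iff)
  then interpret L: complex_subring L by blast
  have KQ: "K \<subseteq> Qbar" using totally_real_field_Qbar[OF K] by blast
  have "Polynomial.algebraic (csqrt (\<delta> ^ 2))" using \<delta>(2) KQ by (auto simp: Qbar_def)
  moreover have "csqrt (\<delta> ^ 2) = \<delta> \<or> csqrt (\<delta> ^ 2) = - \<delta>"
    using power2_csqrt[of "\<delta> ^ 2"] power2_eq_iff by blast
  ultimately have \<delta>Q: "\<delta> \<in> Qbar" by (auto simp: Qbar_def)
  have LQ: "L \<subseteq> Qbar"
    using gen KQ \<delta>Q by (blast intro: Qbar.add_mem Qbar.mult_mem)
  have real: "\<sigma> x \<in> \<real>" if "embedding \<sigma>" "x \<in> K" for \<sigma> x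
    using K that by (auto simp: totally_real_field_def totally_real_iff_embedding)
  have \<sigma>_gen: "\<sigma> (a + b * \<delta>) = \<sigma> a + \<sigma> b * \<sigma> \<delta>" if "embedding \<sigma>" "a \<in> K" "b \<in> K" for \<sigma> a b
    using that KQ \<delta>Q by (simp add: embedding_add embedding_mult Qbar.mult_mem subset_iff)
  \<comment> \<open>The image of \<delta> has a real square but is not real, as the image of
    \<open>L\<close> would be real too; so its real part is 0.\<close>
  have \<sigma>_\<delta>: "cnj (\<sigma> \<delta>) = - \<sigma> \<delta>" if \<sigma>: "embedding \<sigma>" for \<sigma>
  proof -
    have "\<sigma> \<delta> \<notin> \<real>"
    proof
      assume d: "\<sigma> \<delta> \<in> \<real>"
      have "\<sigma> x \<in> \<real>" if x: "x \<in> L" for x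
      proof -
        obtain a b where ab: "a \<in> K" "b \<in> K" "x = a + b * \<delta>" using gen[OF x] by blast
        show ?thesis unfolding ab(3) \<sigma>_gen[OF \<sigma> ab(1,2)]
          using real[OF \<sigma> ab(1)] real[OF \<sigma> ab(2)] d by simp
      qed
      then show False using totally_imaginary_embedding_not_real[OF L LQ \<sigma>] by blast
    qed
    moreover have "\<sigma> \<delta> ^ 2 \<in> \<real>"
      using real[OF \<sigma> \<delta>(2)] by (simp add: embedding_power[OF \<sigma> \<delta>Q])
    ultimately have "Re (\<sigma> \<delta>) = 0" by (auto simp: complex_is_Real_iff power2_eq_square)
    then show ?thesis by (simp add: complex_eq_iff)
  qed
  have cnj_gen: "cnj (\<sigma> (a + b * \<delta>)) = \<sigma> (a - b * \<delta>)" if \<sigma>: "embedding \<sigma>" and ab: "a \<in> K" "b \<in> K" for \<sigma> a b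
  proof -
    have "cnj (\<sigma> (a + b * \<delta>)) = \<sigma> a - \<sigma> b * \<sigma> \<delta>"
      using real[OF \<sigma> ab(1)] real[OF \<sigma> ab(2)] \<sigma>_\<delta>[OF \<sigma>] by (simp add: \<sigma>_gen[OF \<sigma> ab] Reals_cnj_iff)
    then show ?thesis
      using \<sigma> ab KQ \<delta>Q by (simp add: embedding_diff embedding_mult Qbar.mult_mem subset_iff)
  qed
  show ?thesis
  proof
    fix x assume x: "x \<in> L"
    then obtain a b where ab: "a \<in> K" "b \<in> K" "x = a + b * \<delta>" using gen by blast
    \<comment> \<open>The identity embedding shows how \<open>cnj\<close> itself acts on
      \<open>L\<close>.\<close>
    have cx: "cnj x = a - b * \<delta>" using cnj_gen[OF embedding_id ab(1,2)] ab(3) by simp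
    show "cnj x \<in> L" unfolding cx using ab sub(2) \<delta>(1) by (auto intro!: L.diff_mem L.mult_mem)
    show "\<sigma> (cnj x) = cnj (\<sigma> x)" if "embedding \<sigma>" for \<sigma>
      using cnj_gen[OF that ab(1,2)] by (simp only: cx flip: ab(3))
  next
    show "complex_of_real (sqrt (of_nat m)) \<in> L" for m using sqrt sub(2) by blast
  qed (use LQ in auto)
qed

theorem theorem4p4:
  fixes K0 K1 K L :: "complex set"
  assumes "totally_real_field K0"
    and "JR_attained (ring_of_integers K0) \<or> JR (ring_of_integers K0) = \<infinity>"
    and "maximal_totally_real_subfield K1 (compositum2 K0)"
    and "totally_real_field K" and "K1 \<subseteq> K"
    and "JR (ring_of_integers K) = JR (ring_of_integers K0)"
    and "extension_of_degree 2 K L" and "totally_imaginary_field L"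
  shows "\<not> decidable (first_order_theory (ring_of_integers L))"
proof -
  have "complex_of_real (sqrt (of_nat m)) \<in> K" for m
    using sqrt_in_maximal_totally_real_subfield[OF assms(1,3)] assms(5) by blast
  then interpret cm_field L
    using assms(4,7,8) by (intro cm_fieldI)
  show ?thesis by (rule not_decidable)
qed

end
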